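(* Let $p\ge1$, $n,d,K\in\mathbb{N}$, $\Omega\subseteq\mathbb{R}^d$ compact, and consider graphs in $G_{\le n}(\Omega)$ with node set contained in $\{1,\dots,n\}$. Thin-SortMPNN of depth $K$ is defined by $x_v^{(0)}=x_v$ and for $k=1,\dots,K$: $$c_v^{(k)}=\mathrm{sort}\big(a^{(k)}\cdot x^{(k-1)}_{v,\bullet}\big)\in\mathbb{R}^n,\qquad x_v^{(k)}=d^{(k)}\cdot\mathrm{concat}(x_v^{(k-1)},c_v^{(k)})\in\mathbb{R},$$ with readout $c^{\mathrm{global}}=b^{(K+1)}\cdot\mathrm{sort}\big(a^{(K+1)}\cdot x^{(K)}_{\bullet}\big)$, where $x^{(k-1)}_{v,\bullet}=(x^{(k-1)}_{v,1},\dots,x^{(k-1)}_{v,n})$ with $x^{(k-1)}_{v,s}=x^{(k-1)}_s$ if $(v,s)\in E$ and $x^{(k-1)}_{v,s}=z_{k-1}$ otherwise; $x^{(K)}_\bullet=(x^{(K)}_1,\dots,x^{(K)}_n)$ with $x^{(K)}_s=z_K$ if $s\notin V$; $a\cdot(y_1,\dots,y_n)=(a\cdot y_1,\dots,a\cdot y_n)$; and $\mathrm{sort}$ sorts nondecreasingly. All parameters $a^{(k)},b^{(K+1)},d^{(k)}$ are independent and uniform on the unit spheres of the appropriate dimensions. Let $\Omega_k$ be the (compact) set of all attainable values $x_v^{(k)}$ over graphs, nodes and parameters, and assume $z_k\notin\Omega_k$ for $k=0,\dots,K$ ($\Omega_0=\Omega$). Then there exist $c_1,c_2>0$ such that: (1)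 for each $0\le k\le K$ and all nodes $u,v$ of graphs in $G_{\le n}(\Omega)$, $\mathbb{E}\big[\|x_v^{(k)}-x_u^{(k)}\|_p^p\big]\ge c_1\,TD^p(T_v^{(k)},T_u^{(k)})$; (2) for all $G,\hat G\in G_{\le n}(\Omega)$, $\mathbb{E}\big[|c^{\mathrm{global}}-\hat c^{\mathrm{global}}|^p\big]\ge c_2\,TMD^{(K)}(G,\hat G)^p$, where the expectations are over all parameters.
   Context: $G_{\le n}(\Omega)$ is the set of graphs $G=(V,E,X)$ with $|V|\le n$ and node features in $\Omega$. Fix $z\in\mathbb{R}^d\setminus\Omega$ for the tree distances. Computation trees: $T_v^{(0)}$ is a single root node with feature $x_v$; $T_v^{(k)}$ is obtained from $T_v^{(k-1)}$ by attaching to each leaf (corresponding to graph node $u$) children corresponding to the neighbors of $u$, each with its feature. The blank tree $\bar T_z$ is a single node with feature $z$. For a rooted tree $T$ with root $r$, $\mathcal T_r$ is the multiset of subtrees rooted at the children of $r$. For multisets of trees $A,B$ of size at most $n$, $W^{(\bar T_z)}_{TD,1}(A,B)=\min_{\tau\in S_n}\sum_{j=1}^n TD(A'_j,B'_{\tau(j)})$ with $A',B'$ padded by copies of $\bar T_z$ to $n$ elements. $TD(T_a,T_b)=\|x_a-x_b\|_p+W^{(\bar T_z)}_{TD,1}(\mathcal T_a,\mathcal T_b)$ if the maximal depth of $T_a,T_b$ is positive and $\|x_a-x_b\|_p$ otherwise ($x_a,x_b$ root features). $TMD^{(K)}(G,H)=W^{(\bar T_z)}_{TD,1}(\{\!\!\{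 T_v^{(K)}:v\in V_G\}\!\!\},\{\!\!\{ T_u^{(K)}:u\in V_H\}\!\!\})$. *)

theory Defs
  imports "HOL-Analysis.Analysis"
begin

section \<open>Vectors in R^m, represented as functions nat => real (coordinates 0..m-1)\<close>

definition dotp :: "nat \<Rightarrow> (nat \<Rightarrow> real) \<Rightarrow> (nat \<Rightarrow> real) \<Rightarrow> real" where
  "dotp m a y = (\<Sum>i<m. a i * y i)"

definition pnorm :: "nat \<Rightarrow> real \<Rightarrow> (nat \<Rightarrow> real) \<Rightarrow> real" where
  "pnorm m p x = (\<Sum>i<m. \<bar>x i\<bar> powr p) powr (1 / p)"

definition supported :: "nat \<Rightarrow> (nat \<Rightarrow> real) \<Rightarrow> bool" where
  "supported m x \<longleftrightarrow> (\<forall>i\<ge>m. x i = 0)"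

text \<open>Uniform probability measure on the unit sphere of R^m: the normalised
  (cone) surface measure, obtained as the push-forward of the uniform
  distribution on the closed unit ball under radial projection.\<close>

definition unit_ball_set :: "nat \<Rightarrow> (nat \<Rightarrow> real) set" where
  "unit_ball_set m = {x \<in> PiE {..<m} (\<lambda>_. UNIV). (\<Sum>i<m. (x i)\<^sup>2) \<le> 1}"

definition unif_sphere :: "nat \<Rightarrow> (nat \<Rightarrow> real) measure" where
  "unif_sphere m =
     distr (uniform_measure (PiM {..<m} (\<lambda>_. lborel)) (unit_ball_set m))
           (PiM {..<m} (\<lambda>_. lborel))
           (\<lambda>x. restrict (\<lambda>i. x i / sqrt (\<Sum>j<m. (x j)\<^sup>2)) {..<m})"

definition unit_sphere_set :: "nat \<Rightarrow> (nat \<Rightarrow> real) set" where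
  "unit_sphere_set m = {x \<in> PiE {..<m} (\<lambda>_. UNIV). (\<Sum>i<m. (x i)\<^sup>2) = 1}"

datatype graph = Graph (verts: "nat set") (edges: "(nat \<times> nat) set") (feats: "nat \<Rightarrow> nat \<Rightarrow> real")

definition graph_in :: "nat \<Rightarrow> (nat \<Rightarrow> real) set \<Rightarrow> graph \<Rightarrow> bool" where
  "graph_in n \<Omega> G \<longleftrightarrow> verts G \<subseteq> {1..n} \<and> edges G \<subseteq> verts G \<times> verts G \<and>
     sym (edges G) \<and> (\<forall>v\<in>verts G. feats G v \<in> \<Omega>)"

definition nbrs :: "graph \<Rightarrow> nat \<Rightarrow> nat list" where
  "nbrs G u = sorted_list_of_set {s \<in> verts G. (u, s) \<in> edges G}"

datatype 'a tree = Nd (root: 'a) (kids: "'a tree list")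

fun grow :: "graph \<Rightarrow> nat tree \<Rightarrow> nat tree" where
  "grow G (Nd u []) = Nd u (map (\<lambda>s. Nd s []) (nbrs G u))"
| "grow G (Nd u (c # cs)) = Nd u (map (grow G) (c # cs))"

fun comp_tree_nodes :: "graph \<Rightarrow> nat \<Rightarrow> nat \<Rightarrow> nat tree" where
  "comp_tree_nodes G 0 v = Nd v []"
| "comp_tree_nodes G (Suc k) v = grow G (comp_tree_nodes G k v)"

definition comp_tree :: "graph \<Rightarrow> nat \<Rightarrow> nat \<Rightarrow> (nat \<Rightarrow> real) tree" where
  "comp_tree G k v = map_tree (feats G) (comp_tree_nodes G k v)"

fun depth :: "'a tree \<Rightarrow> nat" where
  "depth (Nd x cs) = (if cs = [] then 0 else Suc (Max (set (map depth cs))))"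

definition pad :: "nat \<Rightarrow> 'a \<Rightarrow> 'a tree list \<Rightarrow> 'a tree list" where
  "pad n z A = A @ replicate (n - length A) (Nd z [])"

definition Wpad :: "nat \<Rightarrow> 'a \<Rightarrow> ('a tree \<Rightarrow> 'a tree \<Rightarrow> real) \<Rightarrow> 'a tree list \<Rightarrow> 'a tree list \<Rightarrow> real" where
  "Wpad n z f A B = Min ((\<lambda>\<tau>. \<Sum>j<n. f (pad n z A ! j) (pad n z B ! \<tau> j)) ` {\<tau>. \<tau> permutes {..<n}})"

lemma Wpad_cong [fundef_cong]:
  assumes "n = n'" "z = z'" "A = A'" "B = B'"
    and "\<And>x y. x \<in> set (pad n z A) \<Longrightarrow> y \<in> set (pad n z B) \<Longrightarrow> f x y = g x y"
  shows "Wpad n z f A B = Wpad n' z' g A' B'"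
proof -
  have "\<And>\<tau> j. \<tau> permutes {..<n} \<Longrightarrow> j < n \<Longrightarrow>
          f (pad n z A ! j) (pad n z B ! \<tau> j) = g (pad n z A ! j) (pad n z B ! \<tau> j)"
  proof -
    fix \<tau> j assume t: "\<tau> permutes {..<n}" and j: "j < n"
    have lA: "length (pad n z A) \<ge> n" and lB: "length (pad n z B) \<ge> n"
      by (auto simp: pad_def)
    have "\<tau> j < n" using permutes_in_image[OF t, of j] j by auto
    then show "f (pad n z A ! j) (pad n z B ! \<tau> j) = g (pad n z A ! j) (pad n z B ! \<tau> j)"
      using assms(5) j lA lB by (meson nth_mem order_less_le_trans)
  qed
  then show ?thesis using assms(1-4) unfolding Wpad_def
    by (intro arg_cong[where f=Min] image_cong refl sum.cong) auto
qed

lemma size_pad_elem: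
  assumes "x \<in> set (pad n z A)"
  shows "x \<in> set A \<or> x = Nd z []"
  using assms by (auto simp: pad_def)

function TD :: "nat \<Rightarrow> nat \<Rightarrow> real \<Rightarrow> (nat \<Rightarrow> real) \<Rightarrow> (nat \<Rightarrow> real) tree \<Rightarrow> (nat \<Rightarrow> real) tree \<Rightarrow> real" where
  "TD n d p z (Nd xa ca) (Nd xb cb) =
     (if 0 < max (depth (Nd xa ca)) (depth (Nd xb cb))
      then pnorm d p (\<lambda>i. xa i - xb i) + Wpad n z (TD n d p z) ca cb
      else pnorm d p (\<lambda>i. xa i - xb i))"
  by pat_completeness auto
termination
proof (relation "Wellfounded.measure (\<lambda>(n, d, p, z, a, b). size a + size b)")
  show "wf (Wellfounded.measure (\<lambda>(n, d, p, z, a, b). size a + size b))" by simp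
next
  fix n d p z xa ca xb cb x y
  assume dp: "0 < max (depth (Nd xa ca)) (depth (Nd xb cb))"
    and x: "x \<in> set (pad n z ca)" and y: "y \<in> set (pad n z cb)"
  have ne: "ca \<noteq> [] \<or> cb \<noteq> []" using dp by (auto split: if_splits)
  have sx: "size x < size (Nd xa ca) \<or> x = Nd z []"
    using size_pad_elem[OF x] by (auto intro: le_imp_less_Suc size_list_estimation')
  have sy: "size y < size (Nd xb cb) \<or> y = Nd z []"
    using size_pad_elem[OF y] by (auto intro: le_imp_less_Suc size_list_estimation')
  have ca: "ca \<noteq> [] \<Longrightarrow> size (Nd xa ca) \<ge> 2" by (cases ca) auto
  have cb: "cb \<noteq> [] \<Longrightarrow> size (Nd xb cb) \<ge> 2" by (cases cb) auto
  show "((n, d, p, z, x, y), n, d, p, z, Nd xa ca, Nd xb cb)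
          \<in> Wellfounded.measure (\<lambda>(n, d, p, z, a, b). size a + size b)"
    using sx sy ne ca cb by auto
qed

definition TMD :: "nat \<Rightarrow> nat \<Rightarrow> real \<Rightarrow> (nat \<Rightarrow> real) \<Rightarrow> nat \<Rightarrow> graph \<Rightarrow> graph \<Rightarrow> real" where
  "TMD n d p z K G H =
     Wpad n z (TD n d p z) (map (comp_tree G K) (sorted_list_of_set (verts G)))
                           (map (comp_tree H K) (sorted_list_of_set (verts H)))"

text \<open>Parameter names: a^(k), d^(k), b^(K+1).\<close>
datatype pname = PA nat | PD nat | PB

definition dimx :: "nat \<Rightarrow> nat \<Rightarrow> nat" where
  "dimx d k = (if k = 0 then d else 1)"

definition pdim :: "nat \<Rightarrow> nat \<Rightarrow> pname \<Rightarrow> nat" where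
  "pdim n d i = (case i of PA k \<Rightarrow> dimx d (k - 1) | PD k \<Rightarrow> dimx d (k - 1) + n | PB \<Rightarrow> n)"

definition pnames :: "nat \<Rightarrow> pname set" where
  "pnames K = PA ` {1..K+1} \<union> PD ` {1..K} \<union> {PB}"

definition param_measure :: "nat \<Rightarrow> nat \<Rightarrow> nat \<Rightarrow> (pname \<Rightarrow> nat \<Rightarrow> real) measure" where
  "param_measure n d K = PiM (pnames K) (\<lambda>i. unif_sphere (pdim n d i))"

definition valid_params :: "nat \<Rightarrow> nat \<Rightarrow> nat \<Rightarrow> (pname \<Rightarrow> nat \<Rightarrow> real) set" where
  "valid_params n d K = PiE (pnames K) (\<lambda>i. unit_sphere_set (pdim n d i))"

definition list_vec :: "real list \<Rightarrow> nat \<Rightarrow> real" where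
  "list_vec c i = (if i < length c then c ! i else 0)"

text \<open>Node features x_v^(k) (as vectors of dimension dimx d k; for k >= 1 a scalar stored at index 0).
  zs k is the padding value z_k.\<close>
fun feat :: "nat \<Rightarrow> nat \<Rightarrow> (nat \<Rightarrow> nat \<Rightarrow> real) \<Rightarrow> graph \<Rightarrow> (pname \<Rightarrow> nat \<Rightarrow> real)
             \<Rightarrow> nat \<Rightarrow> nat \<Rightarrow> nat \<Rightarrow> real" where
  "feat n d zs G \<theta> 0 v = feats G v"
| "feat n d zs G \<theta> (Suc k) v =
     (let m = dimx d k;
          nb = (\<lambda>s. if (v, s) \<in> edges G then feat n d zs G \<theta> k s else zs k);
          c = sort (map (\<lambda>s. dotp m (\<theta> (PA (Suc k))) (nb s)) [1..<Suc n]);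
          cat = (\<lambda>i. if i < m then feat n d zs G \<theta> k v i else list_vec c (i - m))
      in (\<lambda>i. if i = 0 then dotp (m + n) (\<theta> (PD (Suc k))) cat else 0))"

definition readout :: "nat \<Rightarrow> nat \<Rightarrow> (nat \<Rightarrow> nat \<Rightarrow> real) \<Rightarrow> nat \<Rightarrow> graph \<Rightarrow> (pname \<Rightarrow> nat \<Rightarrow> real) \<Rightarrow> real" where
  "readout n d zs K G \<theta> =
     (let m = dimx d K;
          xs = (\<lambda>s. if s \<in> verts G then feat n d zs G \<theta> K s else zs K);
          c = sort (map (\<lambda>s. dotp m (\<theta> (PA (Suc K))) (xs s)) [1..<Suc n])
      in dotp n (\<theta> PB) (list_vec c))"

definition Omega_k :: "nat \<Rightarrow> nat \<Rightarrow> (nat \<Rightarrow> real) set \<Rightarrow> (nat \<Rightarrow> nat \<Rightarrow> real) \<Rightarrow> nat \<Rightarrow> nat \<Rightarrow> (nat \<Rightarrow> real) set" where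
  "Omega_k n d \<Omega> zs K k =
     {feat n d zs G \<theta> k v | G \<theta> v. graph_in n \<Omega> G \<and> v \<in> verts G \<and> \<theta> \<in> valid_params n d K}"

end

theory Submission
  imports Defs "HOL-Probability.Infinite_Product_Measure"
begin

text \<open>
  Taking expectations layer by layer fails, because the optimal matching inside the Wasserstein
  distance depends on the parameters and \<open>E min \<le> min E\<close> points the wrong way. Instead the induction
  on \<open>k\<close> carries a statement in probability: for every \<open>\<eta> > 0\<close> there is a uniform \<open>\<epsilon> > 0\<close> with
  \<open>\<parallel>x\<^sub>v - x\<^sub>u\<parallel> \<ge> \<epsilon> TD(T\<^sub>v, T\<^sub>u)\<close> outside an event of probability \<open>\<eta>\<close>. A union bound makes this hold
  for all \<open>n\<^sup>2\<close> pairs of neighbours simultaneously, hence along every matching, in particular along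
  the one chosen by sorting. Each random projection \<open>a \<cdot> w\<close> loses only a constant factor by
  anticoncentration of the uniform measure on the sphere.

  The padding value is separated from the features as follows. For \<open>k = 0\<close> this is compactness of
  \<open>\<Omega>\<close>. For \<open>k \<ge> 1\<close> the projections \<open>a \<cdot> w\<close> of a fixed \<open>w\<close> fill the interval \<open>[-\<parallel>w\<parallel>, \<parallel>w\<parallel>]\<close>, so
  \<open>z\<^sub>k \<notin> \<Omega>\<^sub>k\<close> forces \<open>\<bar>z\<^sub>k\<bar> > \<parallel>w\<parallel>\<close>, while a typical projection stays away from the endpoints.
\<close>

section \<open>The uniform measure on the sphere\<close>

text \<open>The working norm: it is additive over concatenation, and for the difference of two
  sorted lists it is the quantity bounded by \<open>sort_distance_ge_Wpad\<close>. Passing to or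
  from \<open>pnorm\<close> costs a factor \<open>m\<close>.\<close>

definition l1norm :: "nat \<Rightarrow> (nat \<Rightarrow> real) \<Rightarrow> real" where
  "l1norm m x = (\<Sum>i<m. \<bar>x i\<bar>)"

abbreviation lebesgue_fun :: "nat \<Rightarrow> (nat \<Rightarrow> real) measure" where
  "lebesgue_fun m \<equiv> PiM {..<m} (\<lambda>_. lborel)"

lemma l1norm_nonneg [simp]: "0 \<le> l1norm m x"
  by (simp add: l1norm_def sum_nonneg)

lemma abs_le_l1norm: "i < m \<Longrightarrow> \<bar>x i\<bar> \<le> l1norm m x"
  unfolding l1norm_def by (rule member_le_sum) auto

text \<open>Provides the direction along which the slab estimate integrates: the largest coordinate
  carries at least the fraction \<open>1 / m\<close> of the norm.\<close>

lemma l1norm_le_max_coordinate: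
  assumes "0 < m"
  obtains i where "i < m" "l1norm m w \<le> real m * \<bar>w i\<bar>"
proof -
  obtain i where i: "i < m" "\<And>j. j < m \<Longrightarrow> \<bar>w j\<bar> \<le> \<bar>w i\<bar>"
  proof -
    have "Max ((\<lambda>i. \<bar>w i\<bar>) ` {..<m}) \<in> (\<lambda>i. \<bar>w i\<bar>) ` {..<m}"
      using assms by (intro Max_in) auto
    then obtain i where "i < m" "Max ((\<lambda>i. \<bar>w i\<bar>) ` {..<m}) = \<bar>w i\<bar>" by auto
    then show thesis by (intro that) (auto simp flip: \<open>Max _ = _\<close>)
  qed
  have "l1norm m w \<le> (\<Sum>j<m. \<bar>w i\<bar>)"
    unfolding l1norm_def by (rule sum_mono) (use i in auto)
  with i that show thesis by simp
qed

lemma dotp_component_measurable [measurable]: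
  "(\<lambda>x. dotp m x w) \<in> borel_measurable (lebesgue_fun m)"
  unfolding dotp_def by measurable

interpretation lborel_product: product_sigma_finite "\<lambda>_::nat. lborel :: real measure"
  by standard

lemma emeasure_box:
  fixes I :: "nat set"
  assumes "finite I" "0 \<le> r"
  shows "emeasure (PiM I (\<lambda>_. lborel)) (PiE I (\<lambda>_. {-r..r::real})) = ennreal (2 * r) ^ card I"
  using assms by (simp add: lborel_product.emeasure_PiM)

text \<open>Tonelli with coordinate \<open>i\<close> integrated first: for fixed other coordinates
  the slab confines it to an interval of length \<open>2 * c\<close>, and the others range over a
  cube of volume \<open>2 ^ (m - 1)\<close>.\<close>

lemma slab_in_box_emeasure_le:
  assumes i: "i < m" and wi: "w i \<noteq> 0" and c: "0 \<le> c"
  shows "emeasure (lebesgue_fun m)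
     {x \<in> space (lebesgue_fun m). (\<forall>j<m. \<bar>x j\<bar> \<le> 1) \<and> \<bar>dotp m x w\<bar> < c * \<bar>w i\<bar>}
     \<le> ennreal (2 ^ m * c)"
proof -
  define J where "J = {..<m} - {i}"
  have J: "finite J" "i \<notin> J" "insert i J = {..<m}" using i by (auto simp: J_def)
  let ?A = "{x \<in> space (lebesgue_fun m). (\<forall>j<m. \<bar>x j\<bar> \<le> 1) \<and> \<bar>dotp m x w\<bar> < c * \<bar>w i\<bar>}"
  have A: "?A \<in> sets (lebesgue_fun m)" by measurable
  have "emeasure (lebesgue_fun m) ?A = (\<integral>\<^sup>+x. indicator ?A x \<partial>lebesgue_fun m)"
    using A by simp
  also have "\<dots> = (\<integral>\<^sup>+x. (\<integral>\<^sup>+y. indicator ?A (x(i := y)) \<partial>lborel) \<partial>PiM J (\<lambda>_. lborel))"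
    using A lborel_product.product_nn_integral_insert[OF J(1,2), of "indicator ?A"] by (simp add: J(3))
  also have "\<dots> \<le> (\<integral>\<^sup>+x. ennreal (2 * c) * indicator (PiE J (\<lambda>_. {-1..1::real})) x \<partial>PiM J (\<lambda>_. lborel))"
  proof (rule nn_integral_mono)
    fix x :: "nat \<Rightarrow> real" assume x: "x \<in> space (PiM J (\<lambda>_. lborel))"
    \<comment> \<open>The remaining coordinates only translate the condition: after division by
      \<open>w i\<close> it becomes |y + r| < c.\<close>
    define r where "r = (\<Sum>j\<in>J. x j * w j) / w i"
    have dot: "dotp m (x(i := y)) w = (y + r) * w i" for y
    proof -
      have "dotp m (x(i := y)) w = y * w i + (\<Sum>j\<in>J. (x(i := y)) j * w j)"
        unfolding dotp_def J(3)[symmetric] using J(1,2) by simp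
      also have "(\<Sum>j\<in>J. (x(i := y)) j * w j) = (\<Sum>j\<in>J. x j * w j)"
        using J by (intro sum.cong) auto
      also have "y * w i + \<dots> = (y + r) * w i" using wi by (simp add: r_def distrib_right)
      finally show ?thesis .
    qed
    have "indicator ?A (x(i := y)) \<le>
       (indicator {-r-c..-r+c} y * indicator (PiE J (\<lambda>_. {-1..1})) x :: ennreal)" for y
    proof (cases "x(i := y) \<in> ?A")
      case True
      have "\<bar>x j\<bar> \<le> 1" if "j \<in> J" for j
        using True that J by (auto simp: J_def split: if_splits)
      then have "x \<in> PiE J (\<lambda>_. {-1..1})"
        using x by (auto simp: space_PiM PiE_def Pi_def abs_le_iff minus_le_iff)
      moreover have "\<bar>y + r\<bar> * \<bar>w i\<bar> < c * \<bar>w i\<bar>" using True by (simp add: dot abs_mult)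
      then have "\<bar>y + r\<bar> < c" by (rule mult_right_less_imp_less) simp
      then have "y \<in> {-r-c..-r+c}" by auto
      ultimately show ?thesis by (simp split: split_indicator)
    qed simp
    then have "(\<integral>\<^sup>+y. indicator ?A (x(i := y)) \<partial>lborel)
        \<le> (\<integral>\<^sup>+y. indicator {-r-c..-r+c} y * indicator (PiE J (\<lambda>_. {-1..1})) x \<partial>lborel)"
      by (intro nn_integral_mono) 
    also have "\<dots> = ennreal (2 * c) * indicator (PiE J (\<lambda>_. {-1..1})) x"
      using c by (subst nn_integral_multc) auto
    finally show "(\<integral>\<^sup>+y. indicator ?A (x(i := y)) \<partial>lborel) \<le> \<dots>" .
  qed
  also have "\<dots> = ennreal (2 * c) * emeasure (PiM J (\<lambda>_. lborel)) (PiE J (\<lambda>_. {-1..1::real}))"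
    by (rule nn_integral_cmult_indicator) (auto intro!: sets_PiM_I_finite J)
  also have "\<dots> = ennreal (2 * c) * ennreal 2 ^ (m - 1)"
    using emeasure_box[OF J(1), of 1] i by (simp add: J_def)
  also have "\<dots> = ennreal (2 * c * 2 ^ (m - 1))"
    using c ennreal_power[of 2 "m - 1"] by (simp add: ennreal_mult)
  also have "2 * c * 2 ^ (m - 1) = 2 ^ m * c" using i by (cases m) auto
  finally show ?thesis .
qed

lemma unit_ball_set_eq:
  "unit_ball_set m = {x \<in> space (lebesgue_fun m). (\<Sum>i<m. (x i)\<^sup>2) \<le> 1}"
  by (simp add: unit_ball_set_def space_PiM)

lemma sets_unit_ball_set [measurable]: "unit_ball_set m \<in> sets (lebesgue_fun m)"
  unfolding unit_ball_set_eq by measurable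

lemma sum_squares_le_imp_abs_le:
  fixes x :: "nat \<Rightarrow> real"
  assumes "(\<Sum>i<m. (x i)\<^sup>2) \<le> 1" "j < m"
  shows "\<bar>x j\<bar> \<le> 1"
proof -
  have "(x j)\<^sup>2 \<le> (\<Sum>i<m. (x i)\<^sup>2)" using assms(2) by (intro member_le_sum) auto
  then have "(x j)\<^sup>2 \<le> 1" using assms by simp
  then show ?thesis by (simp add: abs_square_le_1)
qed

lemma emeasure_unit_ball_set_finite: "emeasure (lebesgue_fun m) (unit_ball_set m) < \<infinity>"
proof -
  have "unit_ball_set m \<subseteq> PiE {..<m} (\<lambda>_. {-1..1})"
  proof
    fix x assume x: "x \<in> unit_ball_set m"
    have "\<bar>x j\<bar> \<le> 1" if "j < m" for j
      using sum_squares_le_imp_abs_le[of x m j] that x by (auto simp: unit_ball_set_def)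
    then show "x \<in> PiE {..<m} (\<lambda>_. {-1..1})"
      using x by (auto simp: unit_ball_set_def PiE_def Pi_def abs_le_iff minus_le_iff)
  qed
  then have "emeasure (lebesgue_fun m) (unit_ball_set m)
      \<le> emeasure (lebesgue_fun m) (PiE {..<m} (\<lambda>_. {-1..1}))"
    by (rule emeasure_mono) (auto intro!: sets_PiM_I_finite)
  also have "\<dots> = ennreal (2 ^ m)" using emeasure_box[of "{..<m}" 1] ennreal_power[of 2 m] by simp
  also have "\<dots> < \<infinity>" by simp
  finally show ?thesis .
qed

lemma emeasure_unit_ball_set_pos:
  assumes "0 < m" shows "0 < emeasure (lebesgue_fun m) (unit_ball_set m)"
proof -
  \<comment> \<open>In the cube of half side \<open>1 / m\<close> every square is at most
    \<open>1 / m\<close>, so the \<open>m\<close> squares sum to at most 1.\<close>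
  let ?r = "1 / real m"
  have "PiE {..<m} (\<lambda>_. {-?r..?r}) \<subseteq> unit_ball_set m"
  proof
    fix x assume x: "x \<in> PiE {..<m} (\<lambda>_. {-?r..?r})"
    have "(x i)\<^sup>2 \<le> ?r" if "i < m" for i
    proof -
      have "\<bar>x i\<bar> \<le> ?r" using x that by (auto simp: PiE_def Pi_def abs_le_iff minus_le_iff)
      then have "(x i)\<^sup>2 \<le> ?r\<^sup>2" using power_mono[of "\<bar>x i\<bar>" ?r 2] by simp
      also have "\<dots> \<le> ?r" using assms by (simp add: power2_eq_square field_simps)
      finally show ?thesis .
    qed
    then have "(\<Sum>i<m. (x i)\<^sup>2) \<le> (\<Sum>i<m. ?r)" by (intro sum_mono) auto
    then show "x \<in> unit_ball_set m" using x assms by (auto simp: unit_ball_set_def PiE_def)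
  qed
  then have "emeasure (lebesgue_fun m) (PiE {..<m} (\<lambda>_. {-?r..?r}))
      \<le> emeasure (lebesgue_fun m) (unit_ball_set m)"
    by (rule emeasure_mono) measurable
  moreover have "0 < emeasure (lebesgue_fun m) (PiE {..<m} (\<lambda>_. {-?r..?r}))"
    using emeasure_box[of "{..<m}" ?r] assms by (simp add: ennreal_power del: ennreal_eq_0_iff)
  ultimately show ?thesis by (rule order_less_le_trans[rotated])
qed

lemma sets_unif_sphere [measurable_cong]: "sets (unif_sphere m) = sets (lebesgue_fun m)"
  by (simp add: unif_sphere_def)

lemma space_unif_sphere: "space (unif_sphere m) = space (lebesgue_fun m)"
  by (simp add: unif_sphere_def)

lemma normalize_measurable:
  "(\<lambda>x. restrict (\<lambda>i. x i / sqrt (\<Sum>j<m. (x j)\<^sup>2)) {..<m}) \<in> measurable (lebesgue_fun m) (lebesgue_fun m)"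
  by measurable

lemma prob_space_unif_sphere:
  assumes "0 < m" shows "prob_space (unif_sphere m)"
proof -
  interpret U: prob_space "uniform_measure (lebesgue_fun m) (unit_ball_set m)"
    using emeasure_unit_ball_set_pos[OF assms] emeasure_unit_ball_set_finite[of m]
    by (intro prob_space_uniform_measure) auto
  show ?thesis unfolding unif_sphere_def
    by (rule U.prob_space_distr) (use normalize_measurable in simp)
qed

text \<open>The radial projection divides by a norm of at most 1, so a small projection on the
  sphere comes from a small projection in the ball, and the slab estimate is compared with the
  volume of the ball. The constant depends on \<open>m\<close> and \<eta> but not on
  \<open>w\<close>.\<close>

lemma unif_sphere_anticoncentration:
  assumes m: "0 < m" and \<eta>: "0 < (\<eta>::real)"
  obtains \<epsilon> where "0 < \<epsilon>"
    "\<And>w. emeasure (unif_sphere m) {a \<in> space (unif_sphere m). \<bar>dotp m a w\<bar> < \<epsilon> * l1norm m w} \<le> ennreal \<eta>"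
proof -
  let ?L = "lebesgue_fun m" and ?B = "unit_ball_set m"
  let ?N = "\<lambda>x. restrict (\<lambda>i. x i / sqrt (\<Sum>j<m. (x j)\<^sup>2)) {..<m}"
  define V where "V = measure ?L ?B"
  have V: "emeasure ?L ?B = ennreal V"
    using emeasure_unit_ball_set_finite[of m] by (simp add: V_def emeasure_eq_ennreal_measure)
  have V0: "0 < V" using emeasure_unit_ball_set_pos[OF m] by (simp add: V)
  \<comment> \<open>Solves \<open>2 ^ m * (\<epsilon> * m) / V = \<eta>\<close>; the factor
    \<open>m\<close> pays for replacing \<open>l1norm m w\<close> by \<open>m\<close> times one
    coordinate.\<close>
  define \<epsilon> where "\<epsilon> = \<eta> * V / (2 ^ m * m)"
  have \<epsilon>: "0 < \<epsilon>" using m \<eta> V0 by (simp add: \<epsilon>_def)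
  have "emeasure (unif_sphere m) {a \<in> space (unif_sphere m). \<bar>dotp m a w\<bar> < \<epsilon> * l1norm m w} \<le> ennreal \<eta>" for w
  proof -
    obtain i where i: "i < m" "l1norm m w \<le> real m * \<bar>w i\<bar>"
      using l1norm_le_max_coordinate[OF m] .
    let ?S = "{a \<in> space ?L. \<bar>dotp m a w\<bar> < \<epsilon> * l1norm m w}"
    show ?thesis
    \<comment> \<open>If \<open>w i = 0\<close> then \<open>l1norm m w = 0\<close>, and the strict
      inequality has no solution.\<close>
    proof (cases "w i = 0")
      case True
      then have "l1norm m w = 0" using i l1norm_nonneg[of m w] by simp
      then show ?thesis by simp
    next
      case False
      have "emeasure (unif_sphere m) ?S =
          emeasure (uniform_measure ?L ?B) (?N -` ?S \<inter> space ?L)"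
        unfolding unif_sphere_def by (subst emeasure_distr) (use normalize_measurable in auto)
      also have "\<dots> = emeasure ?L (?B \<inter> (?N -` ?S \<inter> space ?L)) / emeasure ?L ?B"
      proof (rule emeasure_uniform_measure)
        have "?S \<in> sets ?L" by measurable
        then show "?N -` ?S \<inter> space ?L \<in> sets ?L"
          by (rule measurable_sets[OF normalize_measurable])
      qed measurable
      also have "\<dots> \<le> ennreal (2 ^ m * (\<epsilon> * m)) / emeasure ?L ?B"
      proof (intro divide_right_mono_ennreal)
        let ?A = "{x \<in> space ?L. (\<forall>j<m. \<bar>x j\<bar> \<le> 1) \<and> \<bar>dotp m x w\<bar> < \<epsilon> * m * \<bar>w i\<bar>}"
        have "?B \<inter> (?N -` ?S \<inter> space ?L) \<subseteq> ?A"
        proof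
          fix x assume x: "x \<in> ?B \<inter> (?N -` ?S \<inter> space ?L)"
          let ?s = "sqrt (\<Sum>j<m. (x j)\<^sup>2)"
          have s: "?s \<le> 1" "0 \<le> ?s" using x by (auto simp: unit_ball_set_def sum_nonneg)
          have eq: "dotp m (?N x) w = dotp m x w / ?s"
            by (simp add: dotp_def sum_divide_distrib)
          have "\<bar>dotp m x w\<bar> \<le> \<bar>dotp m (?N x) w\<bar>"
          \<comment> \<open>At the origin the division by zero returns 0, and both projections
            vanish.\<close>
          proof (cases "?s = 0")
            case True
            then have "\<forall>j<m. x j = 0" by (simp add: sum_nonneg_eq_0_iff)
            then show ?thesis by (simp add: dotp_def)
          next
            case False
            then show ?thesis using s
              by (simp add: eq abs_divide le_divide_eq mult_left_le)
          qed
          also have "\<dots> < \<epsilon> * l1norm m w" using x by simp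
          also have "\<dots> \<le> \<epsilon> * (m * \<bar>w i\<bar>)" using i(2) \<epsilon> by simp
          finally have "\<bar>dotp m x w\<bar> < \<epsilon> * m * \<bar>w i\<bar>" by (simp add: mult.assoc)
          moreover have "\<bar>x j\<bar> \<le> 1" if "j < m" for j
            using sum_squares_le_imp_abs_le[of x m j] that x by (auto simp: unit_ball_set_def)
          ultimately show "x \<in> ?A" using x by auto
        qed
        then have "emeasure ?L (?B \<inter> (?N -` ?S \<inter> space ?L)) \<le> emeasure ?L ?A"
          by (rule emeasure_mono) measurable
        also have "\<dots> \<le> ennreal (2 ^ m * (\<epsilon> * m))"
          by (rule slab_in_box_emeasure_le) (use i False \<epsilon> in auto)
        finally show "emeasure ?L (?B \<inter> (?N -` ?S \<inter> space ?L)) \<le> \<dots>" .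
      qed
      also have "\<dots> = ennreal (2 ^ m * (\<epsilon> * m) / V)"
        using V0 \<epsilon> by (simp add: V divide_ennreal)
      also have "2 ^ m * (\<epsilon> * m) / V = \<eta>"
        using V0 m by (simp add: \<epsilon>_def)
      finally show ?thesis by (simp add: space_unif_sphere)
    qed
  qed
  with \<epsilon> that show thesis by blast
qed

text \<open>Normalisation misses the sphere only at the origin, where division by zero returns the
  zero vector; in positive dimension the origin is a null set.\<close>

lemma emeasure_off_unit_sphere_eq_0:
  assumes m: "0 < m"
  shows "emeasure (unif_sphere m) {a \<in> space (unif_sphere m). a \<notin> unit_sphere_set m} = 0"
proof -
  let ?L = "lebesgue_fun m" and ?B = "unit_ball_set m"
  let ?N = "\<lambda>x. restrict (\<lambda>i. x i / sqrt (\<Sum>j<m. (x j)\<^sup>2)) {..<m}"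
  let ?Z = "{a \<in> space ?L. (\<Sum>i<m. (a i)\<^sup>2) \<noteq> 1}"
  have Z: "?Z \<in> sets ?L" by measurable
  have "emeasure (unif_sphere m) ?Z = emeasure (uniform_measure ?L ?B) (?N -` ?Z \<inter> space ?L)"
    unfolding unif_sphere_def by (subst emeasure_distr) (use normalize_measurable Z in auto)
  also have "\<dots> = emeasure ?L (?B \<inter> (?N -` ?Z \<inter> space ?L)) / emeasure ?L ?B"
    by (rule emeasure_uniform_measure) (use measurable_sets[OF normalize_measurable Z] in auto)
  \<comment> \<open>The origin is written as a box of side zero, so that \<open>emeasure_box\<close>
    measures it.\<close>
  also have "emeasure ?L (?B \<inter> (?N -` ?Z \<inter> space ?L)) \<le> emeasure ?L (PiE {..<m} (\<lambda>_. {-0..0}))"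
  proof (rule emeasure_mono)
    show "?B \<inter> (?N -` ?Z \<inter> space ?L) \<subseteq> PiE {..<m} (\<lambda>_. {-0..0})"
    proof
      fix x assume x: "x \<in> ?B \<inter> (?N -` ?Z \<inter> space ?L)"
      let ?s = "(\<Sum>j<m. (x j)\<^sup>2)"
      have s: "0 \<le> ?s" by (simp add: sum_nonneg)
      have "(\<Sum>i<m. (?N x i)\<^sup>2) = (\<Sum>i<m. (x i)\<^sup>2 / ?s)"
        using s by (intro sum.cong) (auto simp: power_divide)
      also have "\<dots> = ?s / ?s" by (rule sum_divide_distrib[symmetric])
      finally have "(\<Sum>i<m. (?N x i)\<^sup>2) = ?s / ?s" .
      moreover have "(\<Sum>i<m. (?N x i)\<^sup>2) \<noteq> 1" using x by blast
      ultimately have "?s = 0" by (metis divide_self)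
      then have "\<forall>j<m. x j = 0" by (simp add: sum_nonneg_eq_0_iff)
      then show "x \<in> PiE {..<m} (\<lambda>_. {-0..0})" using x
        by (auto simp: space_PiM PiE_def extensional_def fun_eq_iff)
    qed
    show "PiE {..<m} (\<lambda>_. {-0..0}) \<in> sets ?L" by (rule sets_PiM_I_finite) auto
  qed
  also have "emeasure ?L (PiE {..<m} (\<lambda>_. {-0..0})) = 0"
    using m by (subst emeasure_box) (auto simp: power_0_left)
  finally have "emeasure (unif_sphere m) ?Z = 0" by (simp add: divide_right_mono_ennreal)
  moreover have "{a \<in> space (unif_sphere m). a \<notin> unit_sphere_set m} = ?Z"
    by (auto simp: space_unif_sphere unit_sphere_set_def space_PiM)
  ultimately show ?thesis by simp
qed

section \<open>Projections of the sphere onto a line and their extremal values\<close>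

lemma ex_orthogonal_unit_vector:
  assumes "2 \<le> m"
  obtains u :: "nat \<Rightarrow> real" where "dotp m u w = 0" "(\<Sum>i<m. (u i)\<^sup>2) = 1"
proof -
  obtain a b :: real where ab: "a * w 0 + b * w 1 = 0" "a\<^sup>2 + b\<^sup>2 = 1"
  proof (cases "w 0 = 0 \<and> w 1 = 0")
    case True
    then show thesis by (intro that[of 1 0]) auto
  next
    case False
    \<comment> \<open>A quarter turn in the plane of the first two coordinates, normalised:
      \<open>(w 1, - w 0)\<close> is orthogonal to \<open>(w 0, w 1)\<close>.\<close>
    let ?s = "(w 0)\<^sup>2 + (w 1)\<^sup>2"
    have s: "0 < ?s" using False by (metis sum_power2_gt_zero_iff)
    show thesis
    proof (rule that[of "w 1 / sqrt ?s" "- w 0 / sqrt ?s"])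
      show "(w 1 / sqrt ?s)\<^sup>2 + (- w 0 / sqrt ?s)\<^sup>2 = 1"
        using s False by (simp add: power_divide add_divide_distrib[symmetric] add.commute[of "(w 1)\<^sup>2"] del: One_nat_def)
    qed simp
  qed
  define u :: "nat \<Rightarrow> real" where "u = (\<lambda>i. if i = 0 then a else if i = 1 then b else 0)"
  have "{..<m} = insert 0 (insert 1 {2..<m})" using assms by auto
  then have sum: "(\<Sum>i<m. g i) = g 0 + g 1 + (\<Sum>i=2..<m. g i)" for g :: "nat \<Rightarrow> real" by simp
  show thesis
    by (rule that[of u]) (use ab in \<open>auto simp: dotp_def sum u_def\<close>)
qed

text \<open>Used twice: with \<open>x\<close> zero to check that a constructed vector has unit
  length, and with \<open>x\<close> a unit vector to derive Bessel's inequality.\<close>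

lemma sum_squares_combination:
  "(\<Sum>i<m. (x i + b * w i + c * u i)\<^sup>2) =
     (\<Sum>i<m. (x i)\<^sup>2) + b\<^sup>2 * (\<Sum>i<m. (w i)\<^sup>2) + c\<^sup>2 * (\<Sum>i<m. (u i)\<^sup>2)
     + 2 * b * dotp m x w + 2 * c * dotp m x u + 2 * b * c * dotp m u w"
  unfolding dotp_def sum_distrib_left sum.distrib[symmetric]
  by (intro sum.cong) (auto simp: power2_eq_square algebra_simps)

text \<open>A multiple of \<open>w\<close> produces the projection \<open>z\<close>, and a multiple
  of an orthogonal unit vector restores length one; the bound on \<open>z\<close> keeps the square
  root real.\<close>

lemma sphere_projection_attains:
  assumes m: "2 \<le> m" and z: "z\<^sup>2 \<le> (\<Sum>i<m. (w i)\<^sup>2)"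
  obtains a where "a \<in> unit_sphere_set m" "dotp m a w = z"
proof -
  let ?W = "\<Sum>i<m. (w i)\<^sup>2"
  obtain u where u: "dotp m u w = 0" "(\<Sum>i<m. (u i)\<^sup>2) = 1"
    using ex_orthogonal_unit_vector[OF m] .
  have W: "0 \<le> ?W" by (simp add: sum_nonneg)
  \<comment> \<open>The summand 0 matches the shape of \<open>sum_squares_combination\<close>. If
    \<open>?W = 0\<close>, both quotients are 0 by convention and the vector is \<open>u\<close>
    itself.\<close>
  define a where "a = restrict (\<lambda>i. 0 + (z / ?W) * w i + sqrt (1 - z\<^sup>2 / ?W) * u i) {..<m}"
  have le1: "z\<^sup>2 / ?W \<le> 1" using z W by (auto simp: divide_le_eq_1)
  have "(\<Sum>i<m. (a i)\<^sup>2) = (\<Sum>i<m. (0 + (z / ?W) * w i + sqrt (1 - z\<^sup>2 / ?W) * u i)\<^sup>2)"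
    by (simp add: a_def)
  also have "\<dots> = (z / ?W)\<^sup>2 * ?W + (1 - z\<^sup>2 / ?W)"
    unfolding sum_squares_combination using le1 u by (simp add: dotp_def)
  also have "\<dots> = 1" by (simp add: power2_eq_square)
  finally have 1: "a \<in> unit_sphere_set m" by (simp add: unit_sphere_set_def a_def)
  have "dotp m a w = (z / ?W) * ?W + sqrt (1 - z\<^sup>2 / ?W) * dotp m u w"
    unfolding dotp_def sum_distrib_left sum.distrib[symmetric]
    by (intro sum.cong) (auto simp: a_def algebra_simps power2_eq_square)
  also have "\<dots> = z" using z W u by (cases "?W = 0") auto
  finally show thesis using 1 that by blast
qed

text \<open>A direction \<open>u\<close> orthogonal to \<open>w\<close> takes a definite share of the norm of a typical unit
  vector \<open>a\<close>, by Bessel's inequality, so \<open>a \<cdot> w\<close> stays away from the extremal values \<open>\<plusminus>\<parallel>w\<parallel>\<close>.\<close>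
lemma unif_sphere_avoids_poles:
  assumes m: "2 \<le> m" and \<eta>: "0 < (\<eta>::real)"
  obtains \<epsilon> where "0 < \<epsilon>"
    "\<And>w (z::real). (\<Sum>i<m. (w i)\<^sup>2) < z\<^sup>2 \<Longrightarrow>
      emeasure (unif_sphere m) {a \<in> space (unif_sphere m).
        (\<Sum>i<m. (a i)\<^sup>2) = 1 \<and> \<bar>dotp m a w - z\<bar> < \<epsilon> * \<bar>z\<bar>} \<le> ennreal \<eta>"
proof -
  obtain \<delta>0 where \<delta>0: "0 < \<delta>0"
    "\<And>w. emeasure (unif_sphere m) {a \<in> space (unif_sphere m). \<bar>dotp m a w\<bar> < \<delta>0 * l1norm m w} \<le> ennreal \<eta>"
    using unif_sphere_anticoncentration[of m \<eta>] m \<eta> by auto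
  \<comment> \<open>The cap at 1 keeps \<open>1 - \<delta>\<^sup>2\<close> nonnegative.\<close>
  define \<delta> where "\<delta> = min 1 \<delta>0"
  have \<delta>: "0 < \<delta>" "\<delta> \<le> 1" "\<delta> \<le> \<delta>0" using \<delta>0(1) by (auto simp: \<delta>_def)
  show thesis
  \<comment> \<open>Comes from \<open>1 - \<delta>\<^sup>2 \<le> (1 - \<delta>\<^sup>2 /
    2)\<^sup>2\<close>: if \<open>a\<close> has a component of size \<delta> along \<open>u\<close>,
    then |a . w| is at most \<open>\<bar>z\<bar> * (1 - \<delta>\<^sup>2 / 2)\<close>.\<close>
  proof (rule that[of "\<delta>\<^sup>2 / 2"])
    fix w :: "nat \<Rightarrow> real" and z :: real assume wz: "(\<Sum>i<m. (w i)\<^sup>2) < z\<^sup>2"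
    let ?W = "\<Sum>i<m. (w i)\<^sup>2"
    obtain u where u: "dotp m u w = 0" "(\<Sum>i<m. (u i)\<^sup>2) = 1"
      using ex_orthogonal_unit_vector[OF m] .
    \<comment> \<open>Anticoncentration is phrased in the l1 norm, which is at least 1 on Euclidean
      unit vectors because their coordinates are at most 1 in modulus.\<close>
    have l1: "1 \<le> l1norm m u"
    proof -
      have "(\<Sum>i<m. (u i)\<^sup>2) \<le> (\<Sum>i<m. \<bar>u i\<bar>)"
      proof (rule sum_mono)
        fix i assume "i \<in> {..<m}"
        then have "\<bar>u i\<bar> \<le> 1" using sum_squares_le_imp_abs_le[of u m i] u by simp
        then have "\<bar>u i\<bar> * \<bar>u i\<bar> \<le> \<bar>u i\<bar>" by (intro mult_left_le) auto
        then show "(u i)\<^sup>2 \<le> \<bar>u i\<bar>" by (simp add: power2_eq_square)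
      qed
      then show ?thesis by (simp add: u l1norm_def)
    qed
    let ?S = "{a \<in> space (unif_sphere m). (\<Sum>i<m. (a i)\<^sup>2) = 1 \<and> \<bar>dotp m a w - z\<bar> < \<delta>\<^sup>2 / 2 * \<bar>z\<bar>}"
    have "?S \<subseteq> {a \<in> space (unif_sphere m). \<bar>dotp m a u\<bar> < \<delta>0 * l1norm m u}"
    proof
      fix a assume a: "a \<in> ?S"
      have "\<bar>dotp m a u\<bar> < \<delta>"
      proof (rule ccontr)
        assume "\<not> \<bar>dotp m a u\<bar> < \<delta>"
        then have du: "\<delta>\<^sup>2 \<le> (dotp m a u)\<^sup>2"
          using power_mono[of \<delta> "\<bar>dotp m a u\<bar>" 2] \<delta> by simp
        have bessel: "(dotp m a w)\<^sup>2 \<le> ?W * (1 - (dotp m a u)\<^sup>2)"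
        proof (cases "?W = 0")
          case True
          then have "\<forall>i<m. w i = 0" by (simp add: sum_nonneg_eq_0_iff)
          then show ?thesis using True by (simp add: dotp_def)
        next
          case False
          then have W: "0 < ?W" by (metis sum_nonneg zero_le_power2 order_le_less)
          \<comment> \<open>The squared length of what remains of \<open>a\<close> after removing
            its components along the orthogonal vectors \<open>w\<close> and
            \<open>u\<close>.\<close>
          have "0 \<le> (\<Sum>i<m. (a i + (- dotp m a w / ?W) * w i + (- dotp m a u) * u i)\<^sup>2)"
            by (simp add: sum_nonneg)
          also have "\<dots> = 1 - (dotp m a u)\<^sup>2 - (dotp m a w)\<^sup>2 / ?W"
            unfolding sum_squares_combination using a u W by (simp add: power2_eq_square)
          finally show ?thesis using W by (simp add: field_simps)
        qed
        have "?W * (1 - (dotp m a u)\<^sup>2) \<le> ?W * (1 - \<delta>\<^sup>2)"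
          using du by (intro mult_left_mono) (auto simp: sum_nonneg)
        also have "\<dots> \<le> z\<^sup>2 * (1 - \<delta>\<^sup>2)"
          using wz \<delta> by (intro mult_right_mono) (auto simp: power_le_one)
        also have "\<dots> \<le> z\<^sup>2 * (1 - \<delta>\<^sup>2 / 2)\<^sup>2"
          using \<delta> by (intro mult_left_mono) (auto simp: power2_eq_square algebra_simps)
        also have "\<dots> = (\<bar>z\<bar> * (1 - \<delta>\<^sup>2 / 2))\<^sup>2" by (simp add: power_mult_distrib)
        finally have "\<bar>dotp m a w\<bar>\<^sup>2 \<le> (\<bar>z\<bar> * (1 - \<delta>\<^sup>2 / 2))\<^sup>2" using bessel by simp
        moreover have "0 \<le> \<bar>z\<bar> * (1 - \<delta>\<^sup>2 / 2)"
          using \<delta> power_le_one[of \<delta> 2] by (intro mult_nonneg_nonneg) auto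
        ultimately have "\<bar>dotp m a w\<bar> \<le> \<bar>z\<bar> * (1 - \<delta>\<^sup>2 / 2)" by (rule power2_le_imp_le)
        moreover have "\<bar>dotp m a w - z\<bar> < \<delta>\<^sup>2 / 2 * \<bar>z\<bar>" using a by simp
        moreover have "\<bar>z\<bar> \<le> \<bar>dotp m a w\<bar> + \<bar>dotp m a w - z\<bar>" by arith
        ultimately show False by (simp add: algebra_simps)
      qed
      also have "\<delta> \<le> \<delta>0 * l1norm m u" using \<delta> l1 \<delta>0(1) mult_mono[of \<delta> \<delta>0 1 "l1norm m u"] by simp
      finally show "a \<in> {a \<in> space (unif_sphere m). \<bar>dotp m a u\<bar> < \<delta>0 * l1norm m u}" using a by simp
    qed
    then have "emeasure (unif_sphere m) ?S \<le>
       emeasure (unif_sphere m) {a \<in> space (unif_sphere m). \<bar>dotp m a u\<bar> < \<delta>0 * l1norm m u}"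
      by (rule emeasure_mono) measurable
    also have "\<dots> \<le> ennreal \<eta>" by (rule \<delta>0)
    finally show "emeasure (unif_sphere m) ?S \<le> ennreal \<eta>" .
  qed (use \<delta> in auto)
qed

section \<open>Statements outside a set of small probability\<close>

text \<open>The set where \<open>P\<close> fails need not be measurable; it is only covered by a small measurable set.\<close>
definition outside_small :: "'a measure \<Rightarrow> real \<Rightarrow> ('a \<Rightarrow> bool) \<Rightarrow> bool" where
  "outside_small M \<eta> P \<longleftrightarrow> (\<exists>A\<in>sets M. emeasure M A \<le> ennreal \<eta> \<and> (\<forall>x\<in>space M - A. P x))"

lemma outside_small_mono:
  assumes "outside_small M \<eta> P" "\<eta> \<le> \<eta>'" "\<And>x. x \<in> space M \<Longrightarrow> P x \<Longrightarrow> Q x"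
  shows "outside_small M \<eta>' Q"
  using assms unfolding outside_small_def by (meson DiffD1 ennreal_leI order_trans)

lemma outside_small_trivial: "0 \<le> \<eta> \<Longrightarrow> (\<And>x. x \<in> space M \<Longrightarrow> P x) \<Longrightarrow> outside_small M \<eta> P"
  unfolding outside_small_def by (intro bexI[of _ "{}"]) auto

lemma outside_small_conj:
  assumes "outside_small M \<eta> P" "outside_small M \<eta>' Q" "0 \<le> \<eta>" "0 \<le> \<eta>'"
  shows "outside_small M (\<eta> + \<eta>') (\<lambda>x. P x \<and> Q x)"
proof -
  obtain A B where A: "A \<in> sets M" "emeasure M A \<le> ennreal \<eta>" "\<forall>x\<in>space M - A. P x"
    and B: "B \<in> sets M" "emeasure M B \<le> ennreal \<eta>'" "\<forall>x\<in>space M - B. Q x"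
    using assms(1,2) unfolding outside_small_def by blast
  have "emeasure M (A \<union> B) \<le> emeasure M A + emeasure M B"
    using A B by (intro emeasure_subadditive)
  also have "\<dots> \<le> ennreal (\<eta> + \<eta>')" using A B assms(3,4) by (simp add: add_mono)
  finally show ?thesis using A B unfolding outside_small_def by (intro bexI[of _ "A \<union> B"]) auto
qed

lemma outside_small_ball:
  fixes \<eta> :: real
  assumes "finite S" "0 \<le> \<eta>" "\<And>s. s \<in> S \<Longrightarrow> outside_small M \<eta> (P s)"
  shows "outside_small M (card S * \<eta>) (\<lambda>x. \<forall>s\<in>S. P s x)"
  using assms(1,3)
proof (induction S rule: finite_induct)
  case empty
  then show ?case by (auto intro: outside_small_trivial)
next
  case (insert s S)
  have "outside_small M (\<eta> + card S * \<eta>) (\<lambda>x. P s x \<and> (\<forall>s\<in>S. P s x))"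
    using insert assms(2) by (intro outside_small_conj) auto
  then show ?case by (rule outside_small_mono) (use insert in \<open>auto simp: algebra_simps\<close>)
qed

text \<open>Tonelli with coordinate \<open>i\<close> integrated first. This is how the independence
  of one parameter from all others enters: the others are frozen and the bound is uniform in
  them.\<close>

lemma PiM_emeasure_le_of_section:
  fixes M :: "'i \<Rightarrow> 'a measure"
  assumes I: "finite I" "i \<in> I" and M: "\<And>j. prob_space (M j)"
    and A: "A \<in> sets (PiM I M)"
    and le: "\<And>\<theta>. \<theta> \<in> space (PiM I M) \<Longrightarrow> emeasure (M i) {y \<in> space (M i). \<theta>(i := y) \<in> A} \<le> \<eta>"
  shows "emeasure (PiM I M) A \<le> \<eta>"
proof -
  interpret product_sigma_finite M
    by (rule product_sigma_finite.intro) (simp add: M prob_space_imp_sigma_finite)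
  define J where "J = I - {i}"
  have J: "finite J" "i \<notin> J" "insert i J = I" using I by (auto simp: J_def)
  interpret PJ: prob_space "PiM J M" by (rule prob_space_PiM) (rule M)
  \<comment> \<open>A filler for slot \<open>i\<close>: it makes \<open>x\<close> a point of the
    full product, where \<open>le\<close> applies, and is overwritten by the update.\<close>
  obtain y0 where y0: "y0 \<in> space (M i)" using prob_space.not_empty[OF M] by blast
  have "emeasure (PiM I M) A = (\<integral>\<^sup>+x. indicator A x \<partial>PiM I M)" using A by simp
  also have "\<dots> = (\<integral>\<^sup>+x. (\<integral>\<^sup>+y. indicator A (x(i := y)) \<partial>M i) \<partial>PiM J M)"
    using A product_nn_integral_insert[OF J(1,2), of "indicator A"] by (simp add: J(3))
  also have "\<dots> \<le> (\<integral>\<^sup>+x. \<eta> \<partial>PiM J M)"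
  proof (rule nn_integral_mono)
    fix x assume x: "x \<in> space (PiM J M)"
    let ?S = "{y \<in> space (M i). x(i := y) \<in> A}"
    have "(\<lambda>y. x(i := y)) \<in> measurable (M i) (PiM I M)"
      using measurable_component_update[OF x J(2)] by (simp add: J(3))
    from measurable_sets[OF this A] have S: "?S \<in> sets (M i)"
      by (simp add: vimage_def Int_def conj_commute)
    have "(\<integral>\<^sup>+y. indicator A (x(i := y)) \<partial>M i) = (\<integral>\<^sup>+y. indicator ?S y \<partial>M i)"
      by (intro nn_integral_cong) (auto split: split_indicator)
    also have "\<dots> = emeasure (M i) ?S" using S by simp
    also have "?S = {y \<in> space (M i). (x(i := y0))(i := y) \<in> A}" by simp
    also have "emeasure (M i) \<dots> \<le> \<eta>"
    proof (rule le)
      show "x(i := y0) \<in> space (PiM I M)"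
        using x y0 unfolding J(3)[symmetric] by (auto simp: space_PiM PiE_def Pi_def extensional_def)
    qed
    finally show "(\<integral>\<^sup>+y. indicator A (x(i := y)) \<partial>M i) \<le> \<eta>" .
  qed
  also have "\<dots> = \<eta>" by (simp add: PJ.emeasure_space_1)
  finally show ?thesis .
qed

text \<open>Markov's inequality in reverse: \<open>f\<close> is nonnegative and at least
  \<open>c\<close> on a set of probability at least 1/2. It converts probability statements into
  bounds on expectations.\<close>

lemma (in prob_space) integral_ge_of_outside_small:
  fixes f :: "'a \<Rightarrow> real"
  assumes f: "integrable M f" "\<And>x. 0 \<le> f x" and c: "0 \<le> c"
    and out: "outside_small M (1/2) (\<lambda>x. c \<le> f x)"
  shows "c / 2 \<le> (\<integral>x. f x \<partial>M)"
proof -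
  obtain A where A: "A \<in> sets M" "emeasure M A \<le> ennreal (1/2)" "\<forall>x\<in>space M - A. c \<le> f x"
    using out unfolding outside_small_def by blast
  have "prob A \<le> 1/2" using A(2) unfolding emeasure_eq_measure by (subst (asm) ennreal_le_iff) auto
  then have "1/2 \<le> prob (space M - A)" using A(1) by (simp add: prob_compl)
  then have "c * (1/2) \<le> c * prob (space M - A)" using c by (rule mult_left_mono)
  also have "\<dots> = (\<integral>x. c * indicator (space M - A) x \<partial>M)" using A by simp
  also have "\<dots> \<le> (\<integral>x. f x \<partial>M)"
    using A f by (intro integral_mono integrable_mult_right integrable_real_indicator)
      (auto split: split_indicator simp: emeasure_eq_measure)
  finally show ?thesis by simp
qed

section \<open>Sorting and padded matchings\<close>

text \<open>The entries up to \<open>t\<close> form a prefix of a sorted list. Order statistics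
  thereby become counts, which do not change under sorting.\<close>

lemma sorted_nth_le_iff:
  "sorted ys \<Longrightarrow> j < length ys \<Longrightarrow> ys ! j \<le> t \<longleftrightarrow> j < length (filter (\<lambda>x. x \<le> t) ys)"
proof (induction ys arbitrary: j)
  case (Cons a ys)
  show ?case
  proof (cases "a \<le> t")
    case True
    then show ?thesis using Cons by (cases j) auto
  next
    case False
    then have gt: "\<forall>y\<in>set (a # ys). \<not> y \<le> t" using Cons.prems by force
    then have "filter (\<lambda>x. x \<le> t) (a # ys) = []" by (simp add: filter_empty_conv)
    moreover have "\<not> (a # ys) ! j \<le> t" using gt Cons.prems(2) nth_mem by blast
    ultimately show ?thesis by simp
  qed
qed simp

lemma sort_nth_le_iff:
  fixes xs :: "'a::linorder list"
  assumes "j < length xs"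
  shows "sort xs ! j \<le> t \<longleftrightarrow> j < length (filter (\<lambda>x. x \<le> t) xs)"
proof -
  have "length (filter (\<lambda>x. x \<le> t) (sort xs)) = length (filter (\<lambda>x. x \<le> t) xs)"
    by (metis mset_filter mset_sort size_mset)
  then show ?thesis using sorted_nth_le_iff[of "sort xs" j t] assms by simp
qed

text \<open>A sublevel set of an order statistic is described by the number of functions below the
  level, and that number is a finite sum of measurable indicators.\<close>

lemma borel_measurable_sort_nth:
  fixes f :: "'s \<Rightarrow> 'a \<Rightarrow> real"
  assumes "\<And>s. s \<in> set ss \<Longrightarrow> f s \<in> borel_measurable M" and j: "j < length ss"
  shows "(\<lambda>x. sort (map (\<lambda>s. f s x) ss) ! j) \<in> borel_measurable M"
proof (rule borel_measurable_iff_le[THEN iffD2], rule allI)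
  fix t
  have "(\<lambda>x. length (filter (\<lambda>y. y \<le> t) (map (\<lambda>s. f s x) ss))) \<in> measurable M (count_space UNIV)"
    using assms(1)
  proof (induction ss)
    case (Cons s ss)
    have [measurable]: "f s \<in> borel_measurable M"
      "(\<lambda>x. length (filter (\<lambda>y. y \<le> t) (map (\<lambda>s. f s x) ss))) \<in> measurable M (count_space UNIV)"
      using Cons by auto
    have eq: "length (filter (\<lambda>y. y \<le> t) (map (\<lambda>s. f s x) (s # ss))) =
       (if f s x \<le> t then 1 else 0) + length (filter (\<lambda>y. y \<le> t) (map (\<lambda>s. f s x) ss))" for x
      by simp
    show ?case unfolding eq by measurable
  qed simp
  then have "{x \<in> space M. j < length (filter (\<lambda>y. y \<le> t) (map (\<lambda>s. f s x) ss))} \<in> sets M"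
    by measurable
  then show "{x \<in> space M. sort (map (\<lambda>s. f s x) ss) ! j \<le> t} \<in> sets M"
    using j by (simp add: sort_nth_le_iff)
qed

lemma length_pad: "length A \<le> n \<Longrightarrow> length (pad n z A) = n"
  by (simp add: pad_def)

lemma Wpad_le:
  assumes "\<tau> permutes {..<n}"
  shows "Wpad n z f A B \<le> (\<Sum>j<n. f (pad n z A ! j) (pad n z B ! \<tau> j))"
  unfolding Wpad_def using assms by (intro Min_le) (auto intro!: finite_imageI finite_permutations)

lemma Wpad_attained:
  obtains \<tau> where "\<tau> permutes {..<n}"
    "Wpad n z f A B = (\<Sum>j<n. f (pad n z A ! j) (pad n z B ! \<tau> j))"
proof -
  have "Wpad n z f A B \<in> (\<lambda>\<tau>. \<Sum>j<n. f (pad n z A ! j) (pad n z B ! \<tau> j)) ` {\<tau>. \<tau> permutes {..<n}}"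
    unfolding Wpad_def by (intro Min_in) (auto intro!: finite_imageI finite_permutations permutes_id)
  with that show thesis by blast
qed

lemma pad_nth_mem: "j < n \<Longrightarrow> pad n z A ! j \<in> set (pad n z A)"
  by (rule nth_mem) (simp add: pad_def)

lemma Wpad_nonneg:
  assumes "\<And>a b. a \<in> set (pad n z A) \<Longrightarrow> b \<in> set (pad n z B) \<Longrightarrow> 0 \<le> f a b"
  shows "0 \<le> Wpad n z f A B"
proof -
  obtain \<tau> where \<tau>: "\<tau> permutes {..<n}"
    "Wpad n z f A B = (\<Sum>j<n. f (pad n z A ! j) (pad n z B ! \<tau> j))"
    using Wpad_attained .
  show ?thesis unfolding \<tau>(2)
    using permutes_in_image[OF \<tau>(1)] by (intro sum_nonneg assms pad_nth_mem) auto
qed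

text \<open>A matching between rearrangements of the padded lists is, after reindexing, a matching
  of the padded lists themselves.\<close>

lemma Wpad_le_sum_permuted:
  assumes A: "mset ts = mset (pad n z A)" "length A \<le> n"
    and B: "mset us = mset (pad n z B)" "length B \<le> n"
    and \<pi>: "\<pi> permutes {..<n}" and \<rho>: "\<rho> permutes {..<n}"
  shows "Wpad n z f A B \<le> (\<Sum>j<n. f (ts ! \<pi> j) (us ! \<rho> j))"
proof -
  obtain \<alpha> where \<alpha>: "\<alpha> permutes {..<n}" "permute_list \<alpha> (pad n z A) = ts"
    using mset_eq_permutation[OF A(1)] length_pad[OF A(2), of z] by metis
  obtain \<beta> where \<beta>: "\<beta> permutes {..<n}" "permute_list \<beta> (pad n z B) = us"
    using mset_eq_permutation[OF B(1)] length_pad[OF B(2), of z] by metis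
  have ts: "ts ! j = pad n z A ! \<alpha> j" and us: "us ! j = pad n z B ! \<beta> j" if "j < n" for j
    using \<alpha> \<beta> that by (auto simp: permute_list_nth length_pad A B)
  \<comment> \<open>The \<open>j\<close>-th pair sits at positions \<open>\<alpha> (\<pi> j)\<close>
    and \<open>\<beta> (\<rho> j)\<close> of the padded lists; composing with
    \<open>inv \<sigma>\<close> lists the pairs in the order of the first list.\<close>
  define \<sigma> where "\<sigma> = \<alpha> \<circ> \<pi>"
  have \<sigma>: "\<sigma> permutes {..<n}" unfolding \<sigma>_def using \<alpha>(1) \<pi> by (simp add: permutes_compose)
  define \<tau> where "\<tau> = (\<beta> \<circ> \<rho>) \<circ> inv \<sigma>"
  have \<tau>: "\<tau> permutes {..<n}" unfolding \<tau>_def using \<beta>(1) \<rho> \<sigma> by (intro permutes_compose permutes_inv)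
  have "(\<Sum>j<n. f (ts ! \<pi> j) (us ! \<rho> j)) = (\<Sum>j<n. f (pad n z A ! \<sigma> j) (pad n z B ! \<tau> (\<sigma> j)))"
  proof (rule sum.cong)
    fix j assume "j \<in> {..<n}"
    then have "\<pi> j < n" "\<rho> j < n" using permutes_in_image[OF \<pi>] permutes_in_image[OF \<rho>] by auto
    then show "f (ts ! \<pi> j) (us ! \<rho> j) = f (pad n z A ! \<sigma> j) (pad n z B ! \<tau> (\<sigma> j))"
      by (simp add: ts us \<tau>_def permutes_inverses[OF \<sigma>]) (simp add: \<sigma>_def)
  qed simp
  also have "\<dots> = (\<Sum>j<n. f (pad n z A ! j) (pad n z B ! \<tau> j))"
    using sum.permute[OF \<sigma>, of "\<lambda>j. f (pad n z A ! j) (pad n z B ! \<tau> j)"] by (simp add: o_def)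
  finally show ?thesis using Wpad_le[OF \<tau>, of z f A B] by simp
qed

text \<open>The two sorts select some matching. \<open>Wpad\<close> is at most its cost, and since
  \<open>ge\<close> is assumed for all pairs it applies to the selected ones, whichever they
  are.\<close>

lemma sort_distance_ge_Wpad:
  fixes xs ys :: "real list"
  assumes A: "mset ts = mset (pad n z A)" "length A \<le> n"
    and B: "mset us = mset (pad n z B)" "length B \<le> n"
    and len: "length xs = n" "length ys = n" and \<delta>: "0 \<le> \<delta>"
    and ge: "\<And>i j. i < n \<Longrightarrow> j < n \<Longrightarrow> \<delta> * f (ts ! i) (us ! j) \<le> \<bar>xs ! i - ys ! j\<bar>"
  shows "\<delta> * Wpad n z f A B \<le> (\<Sum>j<n. \<bar>sort xs ! j - sort ys ! j\<bar>)"
proof -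
  obtain \<pi> where \<pi>: "\<pi> permutes {..<n}" "permute_list \<pi> xs = sort xs"
    using mset_eq_permutation[of "sort xs" xs] len by auto
  obtain \<rho> where \<rho>: "\<rho> permutes {..<n}" "permute_list \<rho> ys = sort ys"
    using mset_eq_permutation[of "sort ys" ys] len by auto
  have "\<delta> * Wpad n z f A B \<le> \<delta> * (\<Sum>j<n. f (ts ! \<pi> j) (us ! \<rho> j))"
    by (intro mult_left_mono Wpad_le_sum_permuted A B \<pi>(1) \<rho>(1) \<delta>)
  also have "\<dots> \<le> (\<Sum>j<n. \<bar>xs ! \<pi> j - ys ! \<rho> j\<bar>)"
    unfolding sum_distrib_left
  proof (intro sum_mono ge)
    fix j assume "j \<in> {..<n}"
    then show "\<pi> j < n" "\<rho> j < n"
      using permutes_in_image[OF \<pi>(1)] permutes_in_image[OF \<rho>(1)] by auto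
  qed
  also have "\<dots> = (\<Sum>j<n. \<bar>sort xs ! j - sort ys ! j\<bar>)"
    using \<pi> \<rho> len by (intro sum.cong) (auto simp flip: \<pi>(2) \<rho>(2) simp: permute_list_nth)
  finally show ?thesis .
qed

section \<open>Norms and tree distances\<close>

lemma pnorm_nonneg [simp]: "0 \<le> pnorm m p x"
  by (simp add: pnorm_def)

lemma pnorm_minus_commute: "pnorm m p (\<lambda>i. x i - y i) = pnorm m p (\<lambda>i. y i - x i)"
  by (simp add: pnorm_def abs_minus_commute)

lemma l1norm_le_pnorm:
  assumes "1 \<le> p" shows "l1norm m x \<le> real m * pnorm m p x"
proof -
  have "\<bar>x i\<bar> \<le> pnorm m p x" if "i < m" for i
  proof -
    have "\<bar>x i\<bar> = (\<bar>x i\<bar> powr p) powr (1 / p)" using assms by (simp add: powr_powr)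
    also have "\<dots> \<le> pnorm m p x" unfolding pnorm_def
      using assms that by (intro powr_mono2 member_le_sum) auto
    finally show ?thesis .
  qed
  then have "l1norm m x \<le> (\<Sum>i<m. pnorm m p x)" unfolding l1norm_def by (intro sum_mono) auto
  then show ?thesis by simp
qed

lemma pnorm_le_l1norm:
  assumes p: "1 \<le> p" shows "pnorm m p x \<le> real m * l1norm m x"
proof (cases "m = 0")
  case True
  then show ?thesis by (simp add: pnorm_def)
next
  case False
  have "pnorm m p x \<le> (\<Sum>i<m. l1norm m x powr p) powr (1 / p)" unfolding pnorm_def
    using p by (intro powr_mono2 sum_mono abs_le_l1norm sum_nonneg) auto
  also have "\<dots> = real m powr (1 / p) * l1norm m x"
    using p by (simp add: powr_mult powr_powr)
  also have "real m powr (1 / p) \<le> real m powr 1" using False p by (intro powr_mono) auto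
  finally show ?thesis by (simp add: mult_right_mono)
qed

lemma pnorm_1: "0 < p \<Longrightarrow> pnorm 1 p x = \<bar>x 0\<bar>"
  by (simp add: pnorm_def powr_powr)

lemma abs_dotp_le_l1norm:
  assumes "\<And>i. i < m \<Longrightarrow> \<bar>a i\<bar> \<le> 1"
  shows "\<bar>dotp m a x\<bar> \<le> l1norm m x"
proof -
  have "\<bar>dotp m a x\<bar> \<le> (\<Sum>i<m. \<bar>a i * x i\<bar>)" unfolding dotp_def by (rule sum_abs)
  also have "\<dots> \<le> l1norm m x" unfolding l1norm_def
    by (intro sum_mono) (use assms in \<open>auto simp: abs_mult intro!: mult_left_le_one_le\<close>)
  finally show ?thesis .
qed

lemma dotp_diff: "dotp m a (\<lambda>i. x i - y i) = dotp m a x - dotp m a y"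
  by (simp add: dotp_def right_diff_distrib sum_subtractf)

lemma TD_nonneg: "0 \<le> TD n d p z a b"
proof (induction n d p z a b rule: TD.induct)
  case (1 n d p z xa ca xb cb)
  have "0 \<le> Wpad n z (TD n d p z) ca cb" if "0 < max (depth (Nd xa ca)) (depth (Nd xb cb))"
    by (rule Wpad_nonneg) (rule 1[OF that])
  then show ?case by (simp del: depth.simps)
qed

text \<open>For two leaves \<open>TD\<close> omits the Wasserstein term; as that term is
  nonnegative, one inequality covers both branches without mention of depth.\<close>

lemma TD_le_root_plus_Wpad:
  "TD n d p z a b \<le> pnorm d p (\<lambda>i. root a i - root b i) + Wpad n z (TD n d p z) (kids a) (kids b)"
proof -
  have "0 \<le> Wpad n z (TD n d p z) (kids a) (kids b)"
    by (rule Wpad_nonneg) (rule TD_nonneg)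
  then show ?thesis by (cases a; cases b) (simp del: depth.simps)
qed

text \<open>Allows root features to be controlled through trees of the previous depth, which have
  the same roots.\<close>

lemma root_le_TD: "pnorm d p (\<lambda>i. root a i - root b i) \<le> TD n d p z a b"
proof -
  have "0 \<le> Wpad n z (TD n d p z) (kids a) (kids b)"
    by (rule Wpad_nonneg) (rule TD_nonneg)
  then show ?thesis by (cases a; cases b) (simp del: depth.simps)
qed

text \<open>\<open>grow\<close> extends a tree at its leaves, whereas the layers and
  \<open>TD\<close> recurse at the root; here the children become the trees of the
  neighbours.\<close>

lemma comp_tree_nodes_Suc:
  "comp_tree_nodes G (Suc k) v = Nd v (map (comp_tree_nodes G k) (nbrs G v))"
proof (induction k arbitrary: v)
  case (Suc k)
  have "comp_tree_nodes G (Suc (Suc k)) v = grow G (Nd v (map (comp_tree_nodes G k) (nbrs G v)))"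
    using Suc[of v] by simp
  also have "\<dots> = Nd v (map (comp_tree_nodes G (Suc k)) (nbrs G v))"
    \<comment> \<open>Without neighbours the root is itself a leaf and \<open>grow\<close> uses its
      other equation.\<close>
    by (cases "nbrs G v") auto
  finally show ?case .
qed simp

lemma comp_tree_0: "comp_tree G 0 v = Nd (feats G v) []"
  by (simp add: comp_tree_def)

lemma comp_tree_Suc: "comp_tree G (Suc k) v = Nd (feats G v) (map (comp_tree G k) (nbrs G v))"
  unfolding comp_tree_def comp_tree_nodes_Suc by simp

lemma root_comp_tree [simp]: "root (comp_tree G k v) = feats G v"
  by (cases k) (simp_all add: comp_tree_0 comp_tree_Suc)

text \<open>The network keeps a slot for each index in \<open>{1..n}\<close> and pads the absent
  ones in place, while \<open>pad\<close> appends at the end. The multisets agree, which is what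
  \<open>Wpad_le_sum_permuted\<close> asks for.\<close>

lemma mset_map_pad:
  assumes "S \<subseteq> {1..n}"
  shows "mset (map (\<lambda>s. if s \<in> S then f s else Nd z []) [1..<Suc n]) =
         mset (pad n z (map f (sorted_list_of_set S)))"
proof -
  have S: "finite S" using assms finite_subset by blast
  let ?g = "\<lambda>s. if s \<in> S then f s else Nd z []"
  have "mset [1..<Suc n] = mset_set {1..n}"
    by (metis mset_upt atLeastLessThanSuc_atLeastAtMost)
  also have "{1..n} = S \<union> ({1..n} - S)" using assms by auto
  also have "mset_set \<dots> = mset_set S + mset_set ({1..n} - S)"
    using S by (intro mset_set_Union) auto
  finally have "mset (map ?g [1..<Suc n]) =
      image_mset ?g (mset_set S) + image_mset ?g (mset_set ({1..n} - S))"
    by (simp del: upt_Suc)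
  also have "image_mset ?g (mset_set S) = image_mset f (mset_set S)"
    using S by (intro image_mset_cong) auto
  also have "image_mset ?g (mset_set ({1..n} - S)) = image_mset (\<lambda>_. Nd z []) (mset_set ({1..n} - S))"
    by (intro image_mset_cong) auto
  also have "\<dots> = replicate_mset (n - card S) (Nd z [])"
    using assms S by (simp add: image_mset_const_eq card_Diff_subset)
  also have "mset_set S = mset (sorted_list_of_set S)"
    by (metis mset_sorted_list_of_multiset sorted_list_of_mset_set)
  finally show ?thesis using S by (simp add: pad_def del: upt_Suc)
qed

section \<open>Thin-SortMPNN with random parameters\<close>

text \<open>Layer \<open>k\<close> reads only parameters of index at most \<open>k\<close>; hence
  its features are independent of those of layer \<open>k + 1\<close> and of
  \<open>PB\<close>.\<close>

lemma feat_cong: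
  assumes "\<And>j. j \<in> {1..k} \<Longrightarrow> \<theta> (PA j) = \<theta>' (PA j)" "\<And>j. j \<in> {1..k} \<Longrightarrow> \<theta> (PD j) = \<theta>' (PD j)"
  shows "feat n d zs G \<theta> k v = feat n d zs G \<theta>' k v"
  using assms
proof (induction k arbitrary: v)
  case (Suc k)
  have "feat n d zs G \<theta> k s = feat n d zs G \<theta>' k s" for s
    using Suc.prems by (intro Suc.IH) auto
  moreover have "\<theta> (PA (Suc k)) = \<theta>' (PA (Suc k))" "\<theta> (PD (Suc k)) = \<theta>' (PD (Suc k))"
    using Suc.prems by auto
  ultimately show ?case by (simp add: Let_def del: upt_Suc cong: if_cong)
qed simp

locale thin_sort_mpnn =
  fixes p :: real and n d K :: nat
    and \<Omega> :: "(nat \<Rightarrow> real) set"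
    and zs :: "nat \<Rightarrow> nat \<Rightarrow> real"
    and z :: "nat \<Rightarrow> real"
  assumes p: "p \<ge> 1" and n: "n \<ge> 1" and d: "d \<ge> 1"
    and compact_\<Omega>: "compact \<Omega>" and supported_\<Omega>: "\<And>x. x \<in> \<Omega> \<Longrightarrow> supported d x"
    and supported_zs: "\<And>k. supported (dimx d k) (zs k)"
    and zs_notin: "\<And>k. k \<le> K \<Longrightarrow> zs k \<notin> Omega_k n d \<Omega> zs K k"
begin

abbreviation "M \<equiv> param_measure n d K"

lemma dimx_pos: "0 < dimx d k"
  using d by (simp add: dimx_def)

lemma pdim_pos: "0 < pdim n d i"
  using n dimx_pos by (auto simp: pdim_def split: pname.splits)

lemma pdim_PA [simp]: "pdim n d (PA (Suc k)) = dimx d k"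
  and pdim_PD [simp]: "pdim n d (PD (Suc k)) = dimx d k + n"
  and pdim_PB [simp]: "pdim n d PB = n"
  by (simp_all add: pdim_def)

lemma finite_pnames: "finite (pnames K)"
  by (simp add: pnames_def)

lemma PA_in: "k \<le> K \<Longrightarrow> PA (Suc k) \<in> pnames K"
  and PD_in: "Suc k \<le> K \<Longrightarrow> PD (Suc k) \<in> pnames K"
  and PB_in: "PB \<in> pnames K"
  by (auto simp: pnames_def)

lemma prob_space_comp: "prob_space (unif_sphere (pdim n d i))"
  by (rule prob_space_unif_sphere) (rule pdim_pos)

sublocale prob_space M
  unfolding param_measure_def by (rule prob_space_PiM) (rule prob_space_comp)

lemma space_comp: "\<theta> \<in> space M \<Longrightarrow> i \<in> pnames K \<Longrightarrow> \<theta> i \<in> PiE {..<pdim n d i} (\<lambda>_. UNIV)"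
  by (auto simp: param_measure_def space_PiM space_unif_sphere)

lemma comp_measurable:
  assumes "i \<in> pnames K" "j < pdim n d i"
  shows "(\<lambda>\<theta>. \<theta> i j) \<in> borel_measurable M"
proof -
  have 1: "(\<lambda>\<theta>. \<theta> i) \<in> measurable M (unif_sphere (pdim n d i))"
    unfolding param_measure_def using assms(1) by (rule measurable_component_singleton)
  have "(\<lambda>a. a j) \<in> measurable (lebesgue_fun (pdim n d i)) lborel"
    using assms(2) by (intro measurable_component_singleton) auto
  then have "(\<lambda>a. a j) \<in> borel_measurable (unif_sphere (pdim n d i))"
    by (simp add: measurable_cong_sets[OF sets_unif_sphere refl])
  from measurable_compose[OF 1 this] show ?thesis .
qed

lemma dotp_measurable:
  assumes "i \<in> pnames K" "m = pdim n d i"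
    and "\<And>j. j < m \<Longrightarrow> (\<lambda>\<theta>. w \<theta> j) \<in> borel_measurable M"
  shows "(\<lambda>\<theta>. dotp m (\<theta> i) (w \<theta>)) \<in> borel_measurable M"
  unfolding dotp_def using assms
  by (intro borel_measurable_sum borel_measurable_times comp_measurable) auto

lemma emeasure_le_of_section:
  assumes "i \<in> pnames K" "A \<in> sets M"
    and "\<And>\<theta>. \<theta> \<in> space M \<Longrightarrow>
      emeasure (unif_sphere (pdim n d i)) {y \<in> space (unif_sphere (pdim n d i)). \<theta>(i := y) \<in> A} \<le> \<eta>"
  shows "emeasure M A \<le> \<eta>"
  using assms unfolding param_measure_def
  by (intro PiM_emeasure_le_of_section[OF finite_pnames]) (auto intro: prob_space_comp)

text \<open>Independence in functional form: \<open>w\<close> is constant along coordinate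
  \<open>i\<close> of the product, so on each section it is a fixed vector.\<close>

definition independent_of :: "pname \<Rightarrow> ((pname \<Rightarrow> nat \<Rightarrow> real) \<Rightarrow> nat \<Rightarrow> real) \<Rightarrow> bool" where
  "independent_of i w \<longleftrightarrow> (\<forall>j<pdim n d i. (\<lambda>\<theta>. w \<theta> j) \<in> borel_measurable M) \<and>
     (\<forall>\<theta> y. w (\<theta>(i := y)) = w \<theta>)"

text \<open>On every section \<open>w\<close> is a fixed vector and the estimate on the sphere is
  uniform in that vector, so one \<epsilon> serves all random \<open>w\<close>.\<close>

lemma dotp_anticoncentration:
  assumes i: "i \<in> pnames K" and \<eta>: "0 < \<eta>"
  obtains \<epsilon> where "0 < \<epsilon>"
    "\<And>w. independent_of i w \<Longrightarrow>
      outside_small M \<eta> (\<lambda>\<theta>. \<epsilon> * l1norm (pdim n d i) (w \<theta>) \<le> \<bar>dotp (pdim n d i) (\<theta> i) (w \<theta>)\<bar>)"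
proof -
  let ?m = "pdim n d i"
  obtain \<epsilon> where \<epsilon>: "0 < \<epsilon>"
    "\<And>w. emeasure (unif_sphere ?m) {a \<in> space (unif_sphere ?m). \<bar>dotp ?m a w\<bar> < \<epsilon> * l1norm ?m w} \<le> ennreal \<eta>"
    by (rule unif_sphere_anticoncentration[OF pdim_pos[of i] \<eta>]) (rule that)
  show thesis
  proof (rule that[OF \<epsilon>(1)])
    fix w assume "independent_of i w"
    then have w: "\<And>j. j < ?m \<Longrightarrow> (\<lambda>\<theta>. w \<theta> j) \<in> borel_measurable M"
      and indep: "\<And>\<theta> y. w (\<theta>(i := y)) = w \<theta>"
      by (simp_all add: independent_of_def)
    let ?A = "{\<theta> \<in> space M. \<bar>dotp ?m (\<theta> i) (w \<theta>)\<bar> < \<epsilon> * l1norm ?m (w \<theta>)}"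
    have [measurable]: "(\<lambda>\<theta>. dotp ?m (\<theta> i) (w \<theta>)) \<in> borel_measurable M"
      using i w by (intro dotp_measurable) auto
    have [measurable]: "(\<lambda>\<theta>. l1norm ?m (w \<theta>)) \<in> borel_measurable M"
      unfolding l1norm_def using w by (intro borel_measurable_sum borel_measurable_abs) auto
    have A: "?A \<in> sets M" by measurable
    have "emeasure M ?A \<le> ennreal \<eta>"
    proof (rule emeasure_le_of_section[OF i A])
      fix \<theta>
      have "{y \<in> space (unif_sphere ?m). \<theta>(i := y) \<in> ?A} \<subseteq>
         {a \<in> space (unif_sphere ?m). \<bar>dotp ?m a (w \<theta>)\<bar> < \<epsilon> * l1norm ?m (w \<theta>)}"
        by (auto simp: indep)
      then have "emeasure (unif_sphere ?m) {y \<in> space (unif_sphere ?m). \<theta>(i := y) \<in> ?A} \<le>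
         emeasure (unif_sphere ?m) {a \<in> space (unif_sphere ?m). \<bar>dotp ?m a (w \<theta>)\<bar> < \<epsilon> * l1norm ?m (w \<theta>)}"
        by (rule emeasure_mono) measurable
      also have "\<dots> \<le> ennreal \<eta>" by (rule \<epsilon>)
      finally show "emeasure (unif_sphere ?m) {y \<in> space (unif_sphere ?m). \<theta>(i := y) \<in> ?A} \<le> ennreal \<eta>" .
    qed
    then show "outside_small M \<eta> (\<lambda>\<theta>. \<epsilon> * l1norm ?m (w \<theta>) \<le> \<bar>dotp ?m (\<theta> i) (w \<theta>)\<bar>)"
      unfolding outside_small_def using A by (intro bexI[of _ ?A]) auto
  qed
qed

text \<open>\<open>Omega_k\<close> speaks of valid parameters only, while \<open>M\<close> lives on
  a full product space. The difference is a null set, by a section bound for each parameter.\<close>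

lemma outside_small_valid: "outside_small M 0 (\<lambda>\<theta>. \<theta> \<in> valid_params n d K)"
proof -
  have "outside_small M 0 (\<lambda>\<theta>. \<theta> i \<in> unit_sphere_set (pdim n d i))" if i: "i \<in> pnames K" for i
  proof -
    let ?m = "pdim n d i"
    let ?A = "{\<theta> \<in> space M. (\<Sum>j<?m. (\<theta> i j)\<^sup>2) \<noteq> 1}"
    have [measurable]: "(\<lambda>\<theta>. \<Sum>j<?m. (\<theta> i j)\<^sup>2) \<in> borel_measurable M"
      using i by (intro borel_measurable_sum borel_measurable_power comp_measurable) auto
    have A: "?A \<in> sets M" by measurable
    have "emeasure M ?A \<le> 0"
    proof (rule emeasure_le_of_section[OF i A])
      fix \<theta> assume "\<theta> \<in> space M"
      then have "{y \<in> space (unif_sphere ?m). \<theta>(i := y) \<in> ?A} \<subseteq>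
         {a \<in> space (unif_sphere ?m). a \<notin> unit_sphere_set ?m}"
        by (auto simp: unit_sphere_set_def)
      moreover have "{a \<in> space (unif_sphere ?m). a \<notin> unit_sphere_set ?m} =
         {a \<in> space (unif_sphere ?m). (\<Sum>j<?m. (a j)\<^sup>2) \<noteq> 1}"
        by (auto simp: space_unif_sphere unit_sphere_set_def space_PiM)
      moreover have "\<dots> \<in> sets (unif_sphere ?m)" by measurable
      ultimately have "emeasure (unif_sphere ?m) {y \<in> space (unif_sphere ?m). \<theta>(i := y) \<in> ?A} \<le>
         emeasure (unif_sphere ?m) {a \<in> space (unif_sphere ?m). a \<notin> unit_sphere_set ?m}"
        by (intro emeasure_mono) auto
      then show "emeasure (unif_sphere ?m) {y \<in> space (unif_sphere ?m). \<theta>(i := y) \<in> ?A} \<le> 0"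
        using emeasure_off_unit_sphere_eq_0[OF pdim_pos] by simp
    qed
    then show ?thesis
      unfolding outside_small_def using A space_comp[OF _ i]
      by (intro bexI[of _ ?A]) (auto simp: unit_sphere_set_def)
  qed
  then have "outside_small M (real (card (pnames K)) * 0) (\<lambda>\<theta>. \<forall>i\<in>pnames K. \<theta> i \<in> unit_sphere_set (pdim n d i))"
    by (intro outside_small_ball finite_pnames) auto
  then show ?thesis
    by (rule outside_small_mono)
       (auto simp: valid_params_def param_measure_def space_PiM PiE_def)
qed

lemma AE_valid: "AE \<theta> in M. \<theta> \<in> valid_params n d K"
proof -
  obtain A where A: "A \<in> sets M" "emeasure M A = 0" "\<forall>x\<in>space M - A. x \<in> valid_params n d K"
    using outside_small_valid unfolding outside_small_def by auto
  then show ?thesis by (intro AE_I[where N=A]) auto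
qed

lemma valid_abs_le_1:
  "\<theta> \<in> valid_params n d K \<Longrightarrow> i \<in> pnames K \<Longrightarrow> j < pdim n d i \<Longrightarrow> \<bar>\<theta> i j\<bar> \<le> 1"
  by (rule sum_squares_le_imp_abs_le[of _ "pdim n d i"])
     (auto simp: valid_params_def unit_sphere_set_def PiE_def Pi_def)

abbreviation x :: "graph \<Rightarrow> nat \<Rightarrow> nat \<Rightarrow> (pname \<Rightarrow> nat \<Rightarrow> real) \<Rightarrow> nat \<Rightarrow> real" where
  "x G k v \<theta> \<equiv> feat n d zs G \<theta> k v"

text \<open>Common form of both aggregations: \<open>S\<close> is a neighbourhood in a layer and
  \<open>verts G\<close> in the readout.\<close>

definition padded :: "graph \<Rightarrow> nat \<Rightarrow> nat set \<Rightarrow> nat \<Rightarrow> (pname \<Rightarrow> nat \<Rightarrow> real) \<Rightarrow> nat \<Rightarrow> real" where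
  "padded G k S s \<theta> = (if s \<in> S then x G k s \<theta> else zs k)"

text \<open>The index shifts: features of level \<open>k\<close> are projected by the parameter of
  layer \<open>k + 1\<close>, which for \<open>k = K\<close> is that of the readout.\<close>

definition sorted_proj :: "graph \<Rightarrow> nat \<Rightarrow> nat set \<Rightarrow> (pname \<Rightarrow> nat \<Rightarrow> real) \<Rightarrow> real list" where
  "sorted_proj G k S \<theta> = sort (map (\<lambda>s. dotp (dimx d k) (\<theta> (PA (Suc k))) (padded G k S s \<theta>)) [1..<Suc n])"

definition concat_feat :: "graph \<Rightarrow> nat \<Rightarrow> nat \<Rightarrow> (pname \<Rightarrow> nat \<Rightarrow> real) \<Rightarrow> nat \<Rightarrow> real" where
  "concat_feat G k v \<theta> i = (if i < dimx d k then x G k v \<theta> i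
     else list_vec (sorted_proj G k {s. (v, s) \<in> edges G} \<theta>) (i - dimx d k))"

definition tree_dist :: "(nat \<Rightarrow> real) tree \<Rightarrow> (nat \<Rightarrow> real) tree \<Rightarrow> real" where
  "tree_dist = TD n d p z"

lemma feat_Suc:
  "x G (Suc k) v \<theta> =
     (\<lambda>i. if i = 0 then dotp (dimx d k + n) (\<theta> (PD (Suc k))) (concat_feat G k v \<theta>) else 0)"
  by (simp add: concat_feat_def[abs_def] sorted_proj_def padded_def Let_def del: upt_Suc cong: if_cong)

declare feat.simps(2) [simp del]

lemma readout_eq:
  "readout n d zs K G \<theta> = dotp n (\<theta> PB) (list_vec (sorted_proj G K (verts G) \<theta>))"
  by (simp add: readout_def sorted_proj_def padded_def Let_def del: upt_Suc)

lemma length_sorted_proj [simp]: "length (sorted_proj G k S \<theta>) = n"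
  by (simp add: sorted_proj_def del: upt_Suc)

lemma padded_upd:
  "padded G k S s (\<theta>(PA (Suc k) := y)) = padded G k S s \<theta>"
  "padded G k S s (\<theta>(PD (Suc k) := y)) = padded G k S s \<theta>"
  "padded G k S s (\<theta>(PB := y)) = padded G k S s \<theta>"
  unfolding padded_def by (auto intro!: feat_cong)

lemma sorted_proj_upd:
  "sorted_proj G k S (\<theta>(PD (Suc k) := y)) = sorted_proj G k S \<theta>"
  "sorted_proj G k S (\<theta>(PB := y)) = sorted_proj G k S \<theta>"
  unfolding sorted_proj_def by (simp_all add: padded_upd del: upt_Suc)

lemma concat_feat_upd: "concat_feat G k v (\<theta>(PD (Suc k) := y)) = concat_feat G k v \<theta>"
proof -
  have "x G k v (\<theta>(PD (Suc k) := y)) = x G k v \<theta>" by (rule feat_cong) auto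
  then show ?thesis by (intro ext) (simp add: concat_feat_def sorted_proj_upd)
qed

section \<open>Measurability and boundedness of the features\<close>

lemma sorted_proj_measurable_of_feat:
  assumes "k \<le> K" "\<And>s i. i < dimx d k \<Longrightarrow> (\<lambda>\<theta>. x G k s \<theta> i) \<in> borel_measurable M"
  shows "(\<lambda>\<theta>. list_vec (sorted_proj G k S \<theta>) j) \<in> borel_measurable M"
proof (cases "j < n")
  case True
  have "(\<lambda>\<theta>. sorted_proj G k S \<theta> ! j) \<in> borel_measurable M"
    unfolding sorted_proj_def
  proof (rule borel_measurable_sort_nth)
    show "j < length [1..<Suc n]" using True by simp
    fix s
    have "(\<lambda>\<theta>. padded G k S s \<theta> i) \<in> borel_measurable M" if "i < dimx d k" for i
      using assms(2)[OF that] by (cases "s \<in> S") (simp_all add: padded_def)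
    then show "(\<lambda>\<theta>. dotp (dimx d k) (\<theta> (PA (Suc k))) (padded G k S s \<theta>)) \<in> borel_measurable M"
      using PA_in[OF assms(1)] by (intro dotp_measurable) auto
  qed
  then show ?thesis using True by (simp add: list_vec_def)
qed (simp add: list_vec_def)

lemma concat_feat_measurable_of_feat:
  assumes "k \<le> K" "\<And>s i. i < dimx d k \<Longrightarrow> (\<lambda>\<theta>. x G k s \<theta> i) \<in> borel_measurable M"
  shows "(\<lambda>\<theta>. concat_feat G k v \<theta> i) \<in> borel_measurable M"
  using assms(2)[of i v] sorted_proj_measurable_of_feat[OF assms]
  by (cases "i < dimx d k") (simp_all add: concat_feat_def)

lemma feat_measurable:
  assumes "k \<le> K" "i < dimx d k"
  shows "(\<lambda>\<theta>. x G k v \<theta> i) \<in> borel_measurable M"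
  using assms
proof (induction k arbitrary: v i)
  case (Suc k)
  have "(\<lambda>\<theta>. dotp (dimx d k + n) (\<theta> (PD (Suc k))) (concat_feat G k v \<theta>)) \<in> borel_measurable M"
    using Suc PD_in by (intro dotp_measurable concat_feat_measurable_of_feat) auto
  then show ?case unfolding feat_Suc by (cases "i = 0") auto
qed simp

lemmas sorted_proj_measurable = sorted_proj_measurable_of_feat[OF _ feat_measurable]
lemmas concat_feat_measurable = concat_feat_measurable_of_feat[OF _ feat_measurable]

lemma padded_measurable:
  "k \<le> K \<Longrightarrow> i < dimx d k \<Longrightarrow> (\<lambda>\<theta>. padded G k S s \<theta> i) \<in> borel_measurable M"
  using feat_measurable by (cases "s \<in> S") (simp_all add: padded_def)

text \<open>The bound may depend on the graph: it only serves integrability, without which the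
  Bochner integral would take the default value 0.\<close>

lemma sorted_proj_bounded_of_feat:
  assumes k: "k \<le> K"
    and "\<And>s. \<exists>C. \<forall>\<theta>\<in>valid_params n d K. \<forall>i<dimx d k. \<bar>x G k s \<theta> i\<bar> \<le> C"
  shows "\<exists>C. \<forall>\<theta>\<in>valid_params n d K. \<forall>j<n. \<bar>sorted_proj G k S \<theta> ! j\<bar> \<le> C"
proof -
  let ?m = "dimx d k"
  obtain C where C: "\<And>s \<theta> i. \<theta> \<in> valid_params n d K \<Longrightarrow> i < ?m \<Longrightarrow> \<bar>x G k s \<theta> i\<bar> \<le> C s"
    using assms(2) by metis
  define B where "B = (\<lambda>s. real ?m * (\<bar>C s\<bar> + l1norm ?m (zs k)))"
  have B: "0 \<le> B s" for s by (simp add: B_def)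
  \<comment> \<open>Every sorted entry is the projection of some slot; the sum of the nonnegative
    \<open>B s\<close> serves as a bound for all slots.\<close>
  have "\<bar>sorted_proj G k S \<theta> ! j\<bar> \<le> (\<Sum>s=1..n. B s)"
    if \<theta>: "\<theta> \<in> valid_params n d K" and j: "j < n" for \<theta> j
  proof -
    have "sorted_proj G k S \<theta> ! j \<in> set (sorted_proj G k S \<theta>)" using j by (intro nth_mem) simp
    then obtain s where s: "s \<in> {1..n}"
      "sorted_proj G k S \<theta> ! j = dotp ?m (\<theta> (PA (Suc k))) (padded G k S s \<theta>)"
      unfolding sorted_proj_def by (auto simp: less_Suc_eq_le simp del: upt_Suc)
    have "\<bar>sorted_proj G k S \<theta> ! j\<bar> \<le> l1norm ?m (padded G k S s \<theta>)"
      unfolding s(2) by (rule abs_dotp_le_l1norm) (use valid_abs_le_1[OF \<theta> PA_in[OF k]] in simp)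
    also have "\<dots> \<le> (\<Sum>i<?m. \<bar>C s\<bar> + l1norm ?m (zs k))"
      unfolding l1norm_def[of _ "padded G k S s \<theta>"]
    proof (rule sum_mono)
      fix i assume "i \<in> {..<?m}"
      then have "\<bar>x G k s \<theta> i\<bar> \<le> \<bar>C s\<bar>" "\<bar>zs k i\<bar> \<le> l1norm ?m (zs k)"
        using C[OF \<theta>, of i s] abs_le_l1norm[of i ?m "zs k"] by auto
      then show "\<bar>padded G k S s \<theta> i\<bar> \<le> \<bar>C s\<bar> + l1norm ?m (zs k)"
        unfolding padded_def by (smt (verit) l1norm_nonneg)
    qed
    also have "\<dots> = B s" by (simp add: B_def)
    also have "\<dots> \<le> (\<Sum>s=1..n. B s)" using s(1) B by (intro member_le_sum) auto
    finally show ?thesis .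
  qed
  then show ?thesis by blast
qed

text \<open>The two summands will control the two parts of the tree distance: the node's own feature
  the root, the sorted projections the children.\<close>

lemma l1norm_concat_diff:
  "l1norm (dimx d k + n) (\<lambda>i. concat_feat G k v \<theta> i - concat_feat H k u \<theta> i) =
     l1norm (dimx d k) (\<lambda>i. x G k v \<theta> i - x H k u \<theta> i) +
     (\<Sum>j<n. \<bar>sorted_proj G k {s. (v, s) \<in> edges G} \<theta> ! j - sorted_proj H k {s. (u, s) \<in> edges H} \<theta> ! j\<bar>)"
proof -
  have "(\<Sum>i<m + n. f i) = (\<Sum>i<m. f i) + (\<Sum>j<n. f (m + j))" for f :: "nat \<Rightarrow> real" and m
    by (induction n) (auto simp: add.assoc)
  then show ?thesis
    unfolding l1norm_def by (simp add: concat_feat_def list_vec_def)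
qed

lemma feat_bounded:
  assumes "k \<le> K"
  shows "\<exists>C. \<forall>\<theta>\<in>valid_params n d K. \<forall>i<dimx d k. \<bar>x G k v \<theta> i\<bar> \<le> C"
  using assms
proof (induction k arbitrary: v)
  case 0
  have "\<forall>i<dimx d 0. \<bar>feats G v i\<bar> \<le> l1norm (dimx d 0) (feats G v)"
    by (intro allI impI abs_le_l1norm)
  then show ?case by auto
next
  case (Suc k)
  let ?m = "dimx d k" and ?S = "{s. (v, s) \<in> edges G}"
  have k: "k \<le> K" using Suc.prems by simp
  obtain B where B: "\<And>\<theta> j. \<theta> \<in> valid_params n d K \<Longrightarrow> j < n \<Longrightarrow> \<bar>sorted_proj G k ?S \<theta> ! j\<bar> \<le> B"
    using sorted_proj_bounded_of_feat[OF k Suc.IH[OF k], where S="?S"] by blast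
  obtain C where C: "\<And>\<theta> i. \<theta> \<in> valid_params n d K \<Longrightarrow> i < ?m \<Longrightarrow> \<bar>x G k v \<theta> i\<bar> \<le> C"
    using Suc.IH[OF k] by blast
  have "\<bar>x G (Suc k) v \<theta> i\<bar> \<le> real (?m + n) * (\<bar>B\<bar> + \<bar>C\<bar>)" if \<theta>: "\<theta> \<in> valid_params n d K" for \<theta> i
  proof -
    have "\<bar>concat_feat G k v \<theta> i\<bar> \<le> \<bar>B\<bar> + \<bar>C\<bar>" for i
      using B[OF \<theta>, of "i - ?m"] C[OF \<theta>, of i] by (auto simp: concat_feat_def list_vec_def)
    then have "l1norm (?m + n) (concat_feat G k v \<theta>) \<le> (\<Sum>i<?m + n. \<bar>B\<bar> + \<bar>C\<bar>)"
      unfolding l1norm_def by (intro sum_mono)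
    moreover have "\<bar>dotp (?m + n) (\<theta> (PD (Suc k))) (concat_feat G k v \<theta>)\<bar> \<le> l1norm (?m + n) (concat_feat G k v \<theta>)"
      by (rule abs_dotp_le_l1norm) (use valid_abs_le_1[OF \<theta> PD_in[OF Suc.prems]] in simp)
    ultimately show ?thesis unfolding feat_Suc by simp
  qed
  then show ?case by blast
qed

lemma readout_measurable: "readout n d zs K G \<in> borel_measurable M"
  unfolding readout_eq[abs_def]
  using PB_in by (intro dotp_measurable sorted_proj_measurable) auto

lemma readout_bounded: "\<exists>C. \<forall>\<theta>\<in>valid_params n d K. \<bar>readout n d zs K G \<theta>\<bar> \<le> C"
proof -
  obtain B where B: "\<And>\<theta> j. \<theta> \<in> valid_params n d K \<Longrightarrow> j < n \<Longrightarrow> \<bar>sorted_proj G K (verts G) \<theta> ! j\<bar> \<le> B"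
    using sorted_proj_bounded_of_feat[OF order_refl feat_bounded[OF order_refl], where G=G and S="verts G"] by blast
  have "\<bar>readout n d zs K G \<theta>\<bar> \<le> real n * B" if \<theta>: "\<theta> \<in> valid_params n d K" for \<theta>
  proof -
    have "\<bar>readout n d zs K G \<theta>\<bar> \<le> l1norm n (list_vec (sorted_proj G K (verts G) \<theta>))"
      unfolding readout_eq by (rule abs_dotp_le_l1norm) (use valid_abs_le_1[OF \<theta> PB_in] in simp)
    also have "\<dots> \<le> (\<Sum>i<n. B)" unfolding l1norm_def
      by (intro sum_mono) (use B[OF \<theta>] in \<open>simp add: list_vec_def\<close>)
    finally show ?thesis by simp
  qed
  then show ?thesis by blast
qed

section \<open>Separation of node features from each other and from the padding value\<close>

definition separates_nodes :: "nat \<Rightarrow> bool" where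
  "separates_nodes k \<longleftrightarrow> (\<forall>\<eta>>0. \<exists>\<epsilon>>0. \<forall>G H v u.
     graph_in n \<Omega> G \<and> graph_in n \<Omega> H \<and> v \<in> verts G \<and> u \<in> verts H \<longrightarrow>
     outside_small M \<eta> (\<lambda>\<theta>. \<epsilon> * tree_dist (comp_tree G k v) (comp_tree H k u)
        \<le> pnorm (dimx d k) p (\<lambda>i. x G k v \<theta> i - x H k u \<theta> i)))"

text \<open>As in \<open>separates_nodes\<close>, \<epsilon> is chosen before the graphs, while the
  exceptional event may depend on them. The gap is a constant; \<open>tree_dist_bounded\<close>
  later turns it into a multiple of a tree distance.\<close>

definition separates_blank :: "nat \<Rightarrow> bool" where
  "separates_blank k \<longleftrightarrow> (\<forall>\<eta>>0. \<exists>\<epsilon>>0. \<forall>G v. graph_in n \<Omega> G \<and> v \<in> verts G \<longrightarrow>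
     outside_small M \<eta> (\<lambda>\<theta>. \<epsilon> \<le> pnorm (dimx d k) p (\<lambda>i. x G k v \<theta> i - zs k i)))"

lemma separates_nodes_0: "separates_nodes 0"
  unfolding separates_nodes_def
  by (intro allI impI exI[of _ 1] conjI outside_small_trivial)
     (auto simp: comp_tree_0 dimx_def tree_dist_def)

text \<open>The hypothesis on \<open>zs\<close> gives, for valid parameters, a strict inequality
  between the norm of the concatenated vector and the modulus of the padding value, without a
  uniform gap; \<open>unif_sphere_avoids_poles\<close> turns this strictness into a gap proportional
  to the padding value.\<close>

lemma separates_blank_Suc:
  assumes k: "Suc k \<le> K"
  shows "separates_blank (Suc k)"
  unfolding separates_blank_def
proof (intro allI impI)
  fix \<eta> :: real assume \<eta>: "0 < \<eta>"
  let ?m = "dimx d k + n" and ?z = "zs (Suc k) 0" and ?i = "PD (Suc k)"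
  have m: "2 \<le> ?m" using dimx_pos[of k] n by simp
  obtain \<epsilon> where \<epsilon>: "0 < \<epsilon>" "\<And>w (z::real). (\<Sum>i<?m. (w i)\<^sup>2) < z\<^sup>2 \<Longrightarrow>
      emeasure (unif_sphere ?m) {a \<in> space (unif_sphere ?m).
        (\<Sum>i<?m. (a i)\<^sup>2) = 1 \<and> \<bar>dotp ?m a w - z\<bar> < \<epsilon> * \<bar>z\<bar>} \<le> ennreal \<eta>"
    by (rule unif_sphere_avoids_poles[OF m \<eta>]) (rule that)
  \<comment> \<open>Otherwise some unit vector projects the concatenated vector exactly to
    \<open>?z\<close>. That vector does not depend on the parameter \<open>?i\<close>, so replacing
    \<open>?i\<close> would put \<open>zs (Suc k)\<close> into \<open>Omega_k\<close>.\<close>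
  have norm_lt: "(\<Sum>i<?m. (concat_feat G k v \<theta> i)\<^sup>2) < ?z\<^sup>2"
    if G: "graph_in n \<Omega> G" "v \<in> verts G" and \<theta>: "\<theta> \<in> valid_params n d K" for G v \<theta>
  proof (rule ccontr)
    assume "\<not> ?thesis"
    then have "?z\<^sup>2 \<le> (\<Sum>i<?m. (concat_feat G k v \<theta> i)\<^sup>2)" by (simp only: not_less)
    then obtain a where a: "a \<in> unit_sphere_set ?m" "dotp ?m a (concat_feat G k v \<theta>) = ?z"
      by (rule sphere_projection_attains[OF m])
    have "\<theta>(?i := a) \<in> valid_params n d K"
      using \<theta> a(1) PD_in[OF k] by (auto simp: valid_params_def PiE_def Pi_def extensional_def)
    moreover have "x G (Suc k) v (\<theta>(?i := a)) = zs (Suc k)"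
    proof
      fix i
      show "x G (Suc k) v (\<theta>(?i := a)) i = zs (Suc k) i"
        using supported_zs[of "Suc k"] a(2)
        by (cases i) (auto simp: feat_Suc concat_feat_upd supported_def dimx_def)
    qed
    ultimately have "zs (Suc k) \<in> Omega_k n d \<Omega> zs K (Suc k)"
      unfolding Omega_k_def using G
      by (intro CollectI exI[of _ G] exI[of _ "\<theta>(?i := a)"] exI[of _ v]) simp
    then show False using zs_notin[OF k] by blast
  qed
  show "\<exists>\<epsilon>>0. \<forall>G v. graph_in n \<Omega> G \<and> v \<in> verts G \<longrightarrow>
     outside_small M \<eta> (\<lambda>\<theta>. \<epsilon> \<le> pnorm (dimx d (Suc k)) p (\<lambda>i. x G (Suc k) v \<theta> i - zs (Suc k) i))"
  \<comment> \<open>The value 1 is a placeholder: \<open>norm_lt\<close> excludes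
    \<open>?z = 0\<close> once there are a node and valid parameters.\<close>
  proof (intro exI[of _ "if ?z = 0 then 1 else \<epsilon> * \<bar>?z\<bar>"] conjI allI impI)
    show "0 < (if ?z = 0 then 1 else \<epsilon> * \<bar>?z\<bar>)" using \<epsilon>(1) by simp
    fix G v assume G: "graph_in n \<Omega> G \<and> v \<in> verts G"
    let ?c = "concat_feat G k v"
    \<comment> \<open>The norm inequality is part of the event because the section bound must hold
      for every point of the space, also where the parameters are not valid and
      \<open>norm_lt\<close> says nothing.\<close>
    let ?A = "{\<theta> \<in> space M. (\<Sum>i<?m. (?c \<theta> i)\<^sup>2) < ?z\<^sup>2 \<and> (\<Sum>i<?m. (\<theta> ?i i)\<^sup>2) = 1 \<and>
        \<bar>dotp ?m (\<theta> ?i) (?c \<theta>) - ?z\<bar> < \<epsilon> * \<bar>?z\<bar>}"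
    have [measurable]: "(\<lambda>\<theta>. ?c \<theta> i) \<in> borel_measurable M" for i
      using k by (intro concat_feat_measurable) auto
    have [measurable]: "(\<lambda>\<theta>. \<Sum>i<?m. (\<theta> ?i i)\<^sup>2) \<in> borel_measurable M"
      using PD_in[OF k] by (intro borel_measurable_sum borel_measurable_power comp_measurable) auto
    have [measurable]: "(\<lambda>\<theta>. dotp ?m (\<theta> ?i) (?c \<theta>)) \<in> borel_measurable M"
      using PD_in[OF k] by (intro dotp_measurable) auto
    have A: "?A \<in> sets M" by measurable
    have "emeasure M ?A \<le> ennreal \<eta>"
    proof (rule emeasure_le_of_section[OF PD_in[OF k] A], unfold pdim_PD)
      fix \<theta>
      show "emeasure (unif_sphere ?m) {y \<in> space (unif_sphere ?m). \<theta>(?i := y) \<in> ?A} \<le> ennreal \<eta>"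
      proof (cases "(\<Sum>i<?m. (?c \<theta> i)\<^sup>2) < ?z\<^sup>2")
        case True
        have "{y \<in> space (unif_sphere ?m). \<theta>(?i := y) \<in> ?A} \<subseteq> {a \<in> space (unif_sphere ?m).
          (\<Sum>i<?m. (a i)\<^sup>2) = 1 \<and> \<bar>dotp ?m a (?c \<theta>) - ?z\<bar> < \<epsilon> * \<bar>?z\<bar>}"
          by (auto simp: concat_feat_upd)
        then have "emeasure (unif_sphere ?m) {y \<in> space (unif_sphere ?m). \<theta>(?i := y) \<in> ?A} \<le>
          emeasure (unif_sphere ?m) {a \<in> space (unif_sphere ?m).
          (\<Sum>i<?m. (a i)\<^sup>2) = 1 \<and> \<bar>dotp ?m a (?c \<theta>) - ?z\<bar> < \<epsilon> * \<bar>?z\<bar>}"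
          by (rule emeasure_mono) measurable
        also have "\<dots> \<le> ennreal \<eta>" using True by (rule \<epsilon>)
        finally show ?thesis .
      next
        case False
        then have "{y \<in> space (unif_sphere ?m). \<theta>(?i := y) \<in> ?A} = {}"
          by (auto simp: concat_feat_upd)
        then show ?thesis by (simp only: emeasure_empty zero_le)
      qed
    qed
    then have "outside_small M \<eta> (\<lambda>\<theta>. \<theta> \<notin> ?A)"
      unfolding outside_small_def using A by blast
    from outside_small_conj[OF this outside_small_valid] \<eta>
    have "outside_small M (\<eta> + 0) (\<lambda>\<theta>. \<theta> \<notin> ?A \<and> \<theta> \<in> valid_params n d K)" by simp
    then show "outside_small M \<eta> (\<lambda>\<theta>. (if ?z = 0 then 1 else \<epsilon> * \<bar>?z\<bar>)
        \<le> pnorm (dimx d (Suc k)) p (\<lambda>i. x G (Suc k) v \<theta> i - zs (Suc k) i))"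
    proof (rule outside_small_mono)
      fix \<theta> assume \<theta>: "\<theta> \<in> space M" "\<theta> \<notin> ?A \<and> \<theta> \<in> valid_params n d K"
      have lt: "(\<Sum>i<?m. (?c \<theta> i)\<^sup>2) < ?z\<^sup>2" using norm_lt G \<theta> by blast
      then have z0: "?z \<noteq> 0" using sum_nonneg[of "{..<?m}" "\<lambda>i. (?c \<theta> i)\<^sup>2"] by auto
      have "\<theta> ?i \<in> unit_sphere_set ?m"
        using \<theta> PD_in[OF k] by (auto simp: valid_params_def PiE_def Pi_def)
      then have "\<epsilon> * \<bar>?z\<bar> \<le> \<bar>dotp ?m (\<theta> ?i) (?c \<theta>) - ?z\<bar>"
        using \<theta> lt by (auto simp: unit_sphere_set_def)
      then show "(if ?z = 0 then 1 else \<epsilon> * \<bar>?z\<bar>)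
        \<le> pnorm (dimx d (Suc k)) p (\<lambda>i. x G (Suc k) v \<theta> i - zs (Suc k) i)"
        using z0 p pnorm_1[of p] by (simp add: dimx_def feat_Suc)
    qed simp
  qed
qed

text \<open>Every point of \<Omega> is the feature of a one-node graph and so lies in
  \<open>Omega_k\<close> at level 0, provided valid parameters exist; they do, having probability
  one.\<close>

lemma zs_0_notin: "zs 0 \<notin> \<Omega>"
proof
  assume z0: "zs 0 \<in> \<Omega>"
  have "\<exists>\<theta>. \<theta> \<in> valid_params n d K"
  proof (rule ccontr)
    assume "\<not> ?thesis"
    then have "AE \<theta> in M. False" using AE_valid by simp
    then show False by simp
  qed
  then obtain \<theta> where \<theta>: "\<theta> \<in> valid_params n d K" ..
  let ?G = "Graph {1} {} (\<lambda>_. zs 0)"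
  have "graph_in n \<Omega> ?G" using z0 n by (simp add: graph_in_def sym_def)
  moreover have "zs 0 = feat n d zs ?G \<theta> 0 1" "1 \<in> verts ?G" by simp_all
  ultimately have "zs 0 \<in> Omega_k n d \<Omega> zs K 0" unfolding Omega_k_def using \<theta> by blast
  then show False using zs_notin[of 0] by simp
qed

lemma continuous_on_l1norm_diff: "continuous_on S (\<lambda>y. l1norm m (\<lambda>i. y i - c i))"
  unfolding l1norm_def
  by (intro continuous_intros continuous_on_subset[OF continuous_on_product_coordinates]) auto

text \<open>The l1 distance to \<open>zs 0\<close> attains a minimum on the compact \<Omega>. It is
  positive because supported vectors are determined by their first \<open>d\<close> coordinates. The
  bound is deterministic.\<close>

lemma separates_blank_0: "separates_blank 0"
proof (cases "\<Omega> = {}")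
  case True
  then show ?thesis unfolding separates_blank_def by (auto simp: graph_in_def intro!: exI[of _ 1])
next
  case False
  let ?f = "\<lambda>y. l1norm d (\<lambda>i. y i - zs 0 i)"
  obtain y where y: "y \<in> \<Omega>" "\<And>y'. y' \<in> \<Omega> \<Longrightarrow> ?f y \<le> ?f y'"
    using continuous_attains_inf[OF compact_\<Omega> False continuous_on_l1norm_diff] by blast
  have pos: "0 < ?f y"
  proof (rule ccontr)
    assume "\<not> ?thesis"
    then have "?f y = 0" using l1norm_nonneg[of d "\<lambda>i. y i - zs 0 i"] by linarith
    then have "\<forall>i<d. y i = zs 0 i" by (simp add: l1norm_def sum_nonneg_eq_0_iff)
    moreover have "\<forall>i\<ge>d. y i = zs 0 i"
      using supported_\<Omega>[OF y(1)] supported_zs[of 0] by (simp add: supported_def dimx_def)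
    ultimately have "y = zs 0" by (metis ext not_less)
    then show False using y(1) zs_0_notin by simp
  qed
  show ?thesis unfolding separates_blank_def
  proof (intro allI impI exI[of _ "?f y / d"] conjI outside_small_trivial)
    show "0 < ?f y / d" using pos d by simp
    fix G v \<theta> assume "graph_in n \<Omega> G \<and> v \<in> verts G"
    then have "feats G v \<in> \<Omega>" by (simp add: graph_in_def)
    then have "?f y \<le> ?f (feats G v)" by (rule y)
    also have "\<dots> \<le> d * pnorm d p (\<lambda>i. feats G v i - zs 0 i)" by (rule l1norm_le_pnorm[OF p])
    finally show "?f y / d \<le> pnorm (dimx d 0) p (\<lambda>i. x G 0 v \<theta> i - zs 0 i)"
      using d by (simp add: dimx_def field_simps)
  qed simp
qed

lemma separates_blank: "k \<le> K \<Longrightarrow> separates_blank k"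
  using separates_blank_0 separates_blank_Suc by (cases k) auto

section \<open>Uniform bounds on tree distances\<close>

definition trees :: "nat \<Rightarrow> (nat \<Rightarrow> real) tree set" where
  "trees k = insert (Nd z []) {comp_tree G k v | G v. graph_in n \<Omega> G \<and> v \<in> verts G}"

lemma blank_in_trees: "Nd z [] \<in> trees k"
  and comp_tree_in_trees: "graph_in n \<Omega> G \<Longrightarrow> v \<in> verts G \<Longrightarrow> comp_tree G k v \<in> trees k"
  by (auto simp: trees_def)

lemma finite_verts: "graph_in n \<Omega> G \<Longrightarrow> finite (verts G)"
  unfolding graph_in_def using finite_subset by blast

lemma set_nbrs: "graph_in n \<Omega> G \<Longrightarrow> set (nbrs G v) = {s \<in> verts G. (v, s) \<in> edges G}"
  using finite_verts by (simp add: nbrs_def)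

lemma root_trees: "a \<in> trees k \<Longrightarrow> root a \<in> insert z \<Omega>"
  by (auto simp: trees_def graph_in_def)

lemma kids_trees_0: "a \<in> trees 0 \<Longrightarrow> kids a = []"
  by (auto simp: trees_def comp_tree_0)

text \<open>Since the blank tree belongs to every level, padded lists of children stay within the
  next lower level.\<close>

lemma kids_trees_Suc: "a \<in> trees (Suc k) \<Longrightarrow> set (kids a) \<subseteq> trees k"
  by (auto simp: trees_def comp_tree_Suc set_nbrs) blast

lemma tree_dist_blank [simp]: "tree_dist (Nd z []) (Nd z []) = 0"
  by (simp add: tree_dist_def pnorm_def)

lemma tree_dist_nonneg [simp]: "0 \<le> tree_dist a b"
  by (simp add: tree_dist_def TD_nonneg)

text \<open>The l1 norm attains its maximum on the compact set \<open>insert z \<Omega>\<close>, and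
  twice this maximum bounds all l1 differences.\<close>

lemma feature_diameter:
  obtains B where "\<And>a b. a \<in> insert z \<Omega> \<Longrightarrow> b \<in> insert z \<Omega> \<Longrightarrow> pnorm d p (\<lambda>i. a i - b i) \<le> B"
proof -
  have "compact (insert z \<Omega>)" using compact_\<Omega> by (rule compact_insert)
  moreover have "insert z \<Omega> \<noteq> {}" by simp
  ultimately obtain b0 where b0: "\<And>a. a \<in> insert z \<Omega> \<Longrightarrow> l1norm d (\<lambda>i. a i - 0) \<le> l1norm d (\<lambda>i. b0 i - 0)"
    using continuous_attains_sup[OF _ _ continuous_on_l1norm_diff[of _ d "\<lambda>_. 0"]] by metis
  have "pnorm d p (\<lambda>i. a i - b i) \<le> d * (l1norm d b0 + l1norm d b0)"
    if "a \<in> insert z \<Omega>" "b \<in> insert z \<Omega>" for a b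
  proof -
    have "l1norm d (\<lambda>i. a i - b i) \<le> l1norm d a + l1norm d b"
      unfolding l1norm_def sum.distrib[symmetric] by (intro sum_mono) auto
    also have "\<dots> \<le> l1norm d b0 + l1norm d b0" using b0[OF that(1)] b0[OF that(2)] by simp
    finally have "d * l1norm d (\<lambda>i. a i - b i) \<le> d * (l1norm d b0 + l1norm d b0)"
      by (intro mult_left_mono) auto
    with pnorm_le_l1norm[OF p, of d "\<lambda>i. a i - b i"] show ?thesis by linarith
  qed
  then show thesis by (rule that)
qed

text \<open>Each level adds the diameter of the feature set and \<open>n\<close> times the previous
  bound, the latter through the identity matching.\<close>

lemma tree_dist_bounded: "\<exists>C. \<forall>a\<in>trees k. \<forall>b\<in>trees k. tree_dist a b \<le> C"
proof -
  obtain B where B: "\<And>a b. a \<in> insert z \<Omega> \<Longrightarrow> b \<in> insert z \<Omega> \<Longrightarrow> pnorm d p (\<lambda>i. a i - b i) \<le> B"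
    by (rule feature_diameter) (rule that)
  show ?thesis
  proof (induction k)
    case 0
    have "tree_dist a b \<le> B" if "a \<in> trees 0" "b \<in> trees 0" for a b
    proof -
      have "tree_dist a b = pnorm d p (\<lambda>i. root a i - root b i)"
        using kids_trees_0[OF that(1)] kids_trees_0[OF that(2)]
        by (cases a; cases b) (simp add: tree_dist_def)
      then show ?thesis using B root_trees[OF that(1)] root_trees[OF that(2)] by simp
    qed
    then show ?case by blast
  next
    case (Suc k)
    then obtain C where C: "\<And>a b. a \<in> trees k \<Longrightarrow> b \<in> trees k \<Longrightarrow> tree_dist a b \<le> C" by blast
    have "tree_dist a b \<le> B + n * C" if ab: "a \<in> trees (Suc k)" "b \<in> trees (Suc k)" for a b
    proof -
      have mem: "pad n z (kids t) ! j \<in> trees k" if "t \<in> trees (Suc k)" "j < n" for t j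
        using size_pad_elem[OF pad_nth_mem[OF that(2), of z "kids t"]] kids_trees_Suc[OF that(1)]
          blank_in_trees[of k] by auto
      have "Wpad n z tree_dist (kids a) (kids b)
          \<le> (\<Sum>j<n. tree_dist (pad n z (kids a) ! j) (pad n z (kids b) ! id j))"
        by (rule Wpad_le) (rule permutes_id)
      also have "\<dots> \<le> (\<Sum>j<n. C)" using mem ab by (intro sum_mono C) auto
      finally have "Wpad n z tree_dist (kids a) (kids b) \<le> n * C" by simp
      with TD_le_root_plus_Wpad[of n d p z a b] B[OF root_trees[OF ab(1)] root_trees[OF ab(2)]]
      show ?thesis by (simp add: tree_dist_def)
    qed
    then show ?case by blast
  qed
qed

section \<open>Separation of padded slots and of sorted projections\<close>

definition tree_list :: "graph \<Rightarrow> nat \<Rightarrow> nat set \<Rightarrow> (nat \<Rightarrow> real) tree list" where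
  "tree_list G k S = map (comp_tree G k) (sorted_list_of_set S)"

text \<open>Two nodes are covered by \<open>separates_nodes\<close>. If exactly one slot is padding,
  the constant gap \<open>\<epsilon>2\<close> dominates \<open>\<epsilon>2 / C\<close> times the
  tree distance, where \<open>C\<close> bounds all tree distances.\<close>

lemma padded_separated:
  assumes k: "k \<le> K" and sep: "separates_nodes k" and \<eta>: "0 < \<eta>"
  obtains \<epsilon> where "0 < \<epsilon>"
    "\<And>G H S T s t. graph_in n \<Omega> G \<Longrightarrow> graph_in n \<Omega> H \<Longrightarrow> S \<subseteq> verts G \<Longrightarrow> T \<subseteq> verts H \<Longrightarrow>
      outside_small M \<eta> (\<lambda>\<theta>. \<epsilon> * tree_dist (if s \<in> S then comp_tree G k s else Nd z [])
                                        (if t \<in> T then comp_tree H k t else Nd z [])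
        \<le> pnorm (dimx d k) p (\<lambda>i. padded G k S s \<theta> i - padded H k T t \<theta> i))"
proof -
  obtain \<epsilon>1 where \<epsilon>1: "0 < \<epsilon>1" "\<And>G H v u.
     graph_in n \<Omega> G \<and> graph_in n \<Omega> H \<and> v \<in> verts G \<and> u \<in> verts H \<Longrightarrow>
     outside_small M \<eta> (\<lambda>\<theta>. \<epsilon>1 * tree_dist (comp_tree G k v) (comp_tree H k u)
        \<le> pnorm (dimx d k) p (\<lambda>i. x G k v \<theta> i - x H k u \<theta> i))"
    using sep \<eta> unfolding separates_nodes_def by blast
  obtain \<epsilon>2 where \<epsilon>2: "0 < \<epsilon>2" "\<And>G v. graph_in n \<Omega> G \<and> v \<in> verts G \<Longrightarrow>
     outside_small M \<eta> (\<lambda>\<theta>. \<epsilon>2 \<le> pnorm (dimx d k) p (\<lambda>i. x G k v \<theta> i - zs k i))"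
    using separates_blank[OF k] \<eta> unfolding separates_blank_def by blast
  obtain C0 where C0: "\<And>a b. a \<in> trees k \<Longrightarrow> b \<in> trees k \<Longrightarrow> tree_dist a b \<le> C0"
    using tree_dist_bounded by blast
  \<comment> \<open>The modification makes the bound positive, so that it can be divided by.\<close>
  define C where "C = \<bar>C0\<bar> + 1"
  have C: "0 < C" "\<And>a b. a \<in> trees k \<Longrightarrow> b \<in> trees k \<Longrightarrow> tree_dist a b \<le> C"
    using C0 by (fastforce simp: C_def)+
  define \<epsilon> where "\<epsilon> = min \<epsilon>1 (\<epsilon>2 / C)"
  have \<epsilon>: "0 < \<epsilon>" "\<epsilon> \<le> \<epsilon>1" "\<epsilon> * C \<le> \<epsilon>2"
    using \<epsilon>1(1) \<epsilon>2(1) C(1) by (auto simp: \<epsilon>_def min_def field_simps)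
  have blank: "\<epsilon> * tree_dist a b \<le> \<epsilon>2" if "a \<in> trees k" "b \<in> trees k" for a b
    using mult_left_mono[OF C(2)[OF that], of \<epsilon>] \<epsilon> by linarith
  show thesis
  proof (rule that[OF \<epsilon>(1)])
    fix G H S T s t
    assume G: "graph_in n \<Omega> G" "S \<subseteq> verts G" and H: "graph_in n \<Omega> H" "T \<subseteq> verts H"
    let ?goal = "outside_small M \<eta> (\<lambda>\<theta>. \<epsilon> * tree_dist (if s \<in> S then comp_tree G k s else Nd z [])
                                        (if t \<in> T then comp_tree H k t else Nd z [])
        \<le> pnorm (dimx d k) p (\<lambda>i. padded G k S s \<theta> i - padded H k T t \<theta> i))"
    consider "s \<in> S" "t \<in> T" | "s \<in> S" "t \<notin> T" | "s \<notin> S" "t \<in> T" | "s \<notin> S" "t \<notin> T" by blast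
    then show ?goal
    proof cases
      case 1
      then have "outside_small M \<eta> (\<lambda>\<theta>. \<epsilon>1 * tree_dist (comp_tree G k s) (comp_tree H k t)
        \<le> pnorm (dimx d k) p (\<lambda>i. x G k s \<theta> i - x H k t \<theta> i))"
        using G H by (intro \<epsilon>1(2)) auto
      then show ?thesis
        by (rule outside_small_mono)
           (use 1 mult_right_mono[OF \<epsilon>(2) tree_dist_nonneg] in \<open>auto simp: padded_def intro: order_trans\<close>)
    next
      case 2
      then have "outside_small M \<eta> (\<lambda>\<theta>. \<epsilon>2 \<le> pnorm (dimx d k) p (\<lambda>i. x G k s \<theta> i - zs k i))"
        using G by (intro \<epsilon>2(2)) auto
      moreover have "\<epsilon> * tree_dist (comp_tree G k s) (Nd z []) \<le> \<epsilon>2"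
        using 2 G by (intro blank comp_tree_in_trees blank_in_trees) auto
      ultimately show ?thesis
        by (elim outside_small_mono) (use 2 in \<open>auto simp: padded_def intro: order_trans\<close>)
    next
      case 3
      then have "outside_small M \<eta> (\<lambda>\<theta>. \<epsilon>2 \<le> pnorm (dimx d k) p (\<lambda>i. x H k t \<theta> i - zs k i))"
        using H by (intro \<epsilon>2(2)) auto
      moreover have "\<epsilon> * tree_dist (Nd z []) (comp_tree H k t) \<le> \<epsilon>2"
        using 3 H by (intro blank comp_tree_in_trees blank_in_trees) auto
      ultimately show ?thesis
        by (elim outside_small_mono)
           (use 3 in \<open>auto simp: padded_def pnorm_minus_commute[of _ _ "zs k"] intro: order_trans\<close>)
    next
      \<comment> \<open>Both slots are padding: the left side vanishes because the blank tree has
        distance 0 from itself.\<close>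
      case 4
      then show ?thesis using \<eta> by (intro outside_small_trivial) (auto simp: padded_def)
    qed
  qed
qed

text \<open>For each pair of slots two events are needed: the padded features are apart, and the
  fresh parameter \<open>PA (Suc k)\<close> preserves this. Holding for all pairs at once, they feed
  \<open>sort_distance_ge_Wpad\<close>.\<close>

lemma sorted_proj_separated:
  assumes k: "k \<le> K" and sep: "separates_nodes k" and \<eta>: "0 < \<eta>"
  obtains \<epsilon> where "0 < \<epsilon>"
    "\<And>G H S T. graph_in n \<Omega> G \<Longrightarrow> graph_in n \<Omega> H \<Longrightarrow> S \<subseteq> verts G \<Longrightarrow> T \<subseteq> verts H \<Longrightarrow>
      outside_small M \<eta> (\<lambda>\<theta>. \<epsilon> * Wpad n z tree_dist (tree_list G k S) (tree_list H k T)
        \<le> (\<Sum>j<n. \<bar>sorted_proj G k S \<theta> ! j - sorted_proj H k T \<theta> ! j\<bar>))"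
proof -
  let ?m = "dimx d k" and ?P = "{1..n} \<times> {1..n}"
  \<comment> \<open>Shares \<eta> equally among two events for each pair in
    \<open>?P\<close>.\<close>
  define \<eta>' where "\<eta>' = \<eta> / (2 * real (card ?P))"
  have \<eta>': "0 < \<eta>'" "real (card ?P) * (\<eta>' + \<eta>') = \<eta>" using \<eta> n by (auto simp: \<eta>'_def)
  obtain \<epsilon>1 where \<epsilon>1: "0 < \<epsilon>1"
    "\<And>G H S T s t. graph_in n \<Omega> G \<Longrightarrow> graph_in n \<Omega> H \<Longrightarrow> S \<subseteq> verts G \<Longrightarrow> T \<subseteq> verts H \<Longrightarrow>
      outside_small M \<eta>' (\<lambda>\<theta>. \<epsilon>1 * tree_dist (if s \<in> S then comp_tree G k s else Nd z [])
                                        (if t \<in> T then comp_tree H k t else Nd z [])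
        \<le> pnorm ?m p (\<lambda>i. padded G k S s \<theta> i - padded H k T t \<theta> i))"
    by (rule padded_separated[OF k sep \<eta>'(1)]) (rule that)
  obtain \<epsilon>2 where \<epsilon>2: "0 < \<epsilon>2"
    "\<And>w. independent_of (PA (Suc k)) w \<Longrightarrow>
      outside_small M \<eta>' (\<lambda>\<theta>. \<epsilon>2 * l1norm ?m (w \<theta>) \<le> \<bar>dotp ?m (\<theta> (PA (Suc k))) (w \<theta>)\<bar>)"
    by (rule dotp_anticoncentration[OF PA_in[OF k] \<eta>'(1), unfolded pdim_PA]) (rule that)
  \<comment> \<open>The divisor \<open>?m\<close> pays for passing from \<open>pnorm\<close> to
    \<open>l1norm\<close>.\<close>
  define \<epsilon> where "\<epsilon> = \<epsilon>2 * (\<epsilon>1 / ?m)"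
  have m: "0 < real ?m" using dimx_pos by simp
  have \<epsilon>: "0 < \<epsilon>" using \<epsilon>1(1) \<epsilon>2(1) m by (simp add: \<epsilon>_def)
  show thesis
  proof (rule that[OF \<epsilon>])
    fix G H S T
    assume G: "graph_in n \<Omega> G" "S \<subseteq> verts G" and H: "graph_in n \<Omega> H" "T \<subseteq> verts H"
    let ?ts = "\<lambda>s. if s \<in> S then comp_tree G k s else Nd z []"
    let ?us = "\<lambda>t. if t \<in> T then comp_tree H k t else Nd z []"
    let ?a = "\<lambda>\<theta>. \<theta> (PA (Suc k))"
    let ?w = "\<lambda>s t \<theta> i. padded G k S s \<theta> i - padded H k T t \<theta> i"
    let ?E = "\<lambda>(s, t) \<theta>. \<epsilon> * tree_dist (?ts s) (?us t)
        \<le> \<bar>dotp ?m (?a \<theta>) (padded G k S s \<theta>) - dotp ?m (?a \<theta>) (padded H k T t \<theta>)\<bar>"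
    have "outside_small M (\<eta>' + \<eta>') (?E st)" for st
    proof (cases st)
      case (Pair s t)
      have "outside_small M \<eta>' (\<lambda>\<theta>. \<epsilon>2 * l1norm ?m (?w s t \<theta>) \<le> \<bar>dotp ?m (?a \<theta>) (?w s t \<theta>)\<bar>)"
        by (rule \<epsilon>2(2)) (auto simp: independent_of_def padded_upd intro!: borel_measurable_diff padded_measurable k)
      moreover have "outside_small M \<eta>' (\<lambda>\<theta>. \<epsilon>1 * tree_dist (?ts s) (?us t) \<le> pnorm ?m p (?w s t \<theta>))"
        using G H by (intro \<epsilon>1(2))
      ultimately have "outside_small M (\<eta>' + \<eta>')
        (\<lambda>\<theta>. \<epsilon>2 * l1norm ?m (?w s t \<theta>) \<le> \<bar>dotp ?m (?a \<theta>) (?w s t \<theta>)\<bar> \<and>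
             \<epsilon>1 * tree_dist (?ts s) (?us t) \<le> pnorm ?m p (?w s t \<theta>))"
        using \<eta>'(1) by (intro outside_small_conj) auto
      then show ?thesis
      proof (rule outside_small_mono)
        fix \<theta> assume A: "\<epsilon>2 * l1norm ?m (?w s t \<theta>) \<le> \<bar>dotp ?m (?a \<theta>) (?w s t \<theta>)\<bar> \<and>
             \<epsilon>1 * tree_dist (?ts s) (?us t) \<le> pnorm ?m p (?w s t \<theta>)"
        have "\<epsilon>1 * tree_dist (?ts s) (?us t) \<le> ?m * l1norm ?m (?w s t \<theta>)"
          using A pnorm_le_l1norm[OF p] by (meson order_trans)
        then have "\<epsilon>1 / ?m * tree_dist (?ts s) (?us t) \<le> l1norm ?m (?w s t \<theta>)"
          using m by (simp add: field_simps)
        then have "\<epsilon>2 * (\<epsilon>1 / ?m * tree_dist (?ts s) (?us t)) \<le> \<epsilon>2 * l1norm ?m (?w s t \<theta>)"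
          using \<epsilon>2(1) by (intro mult_left_mono) auto
        also have "\<dots> \<le> \<bar>dotp ?m (?a \<theta>) (?w s t \<theta>)\<bar>" using A by blast
        finally show "?E st \<theta>" unfolding Pair by (simp only: \<epsilon>_def mult.assoc dotp_diff prod.case)
      qed simp
    qed
    then have "outside_small M (real (card ?P) * (\<eta>' + \<eta>')) (\<lambda>\<theta>. \<forall>st\<in>?P. ?E st \<theta>)"
      using \<eta>'(1) by (intro outside_small_ball) auto
    then have "outside_small M \<eta> (\<lambda>\<theta>. \<forall>st\<in>?P. ?E st \<theta>)" by (simp only: \<eta>'(2))
    then show "outside_small M \<eta> (\<lambda>\<theta>. \<epsilon> * Wpad n z tree_dist (tree_list G k S) (tree_list H k T)
        \<le> (\<Sum>j<n. \<bar>sorted_proj G k S \<theta> ! j - sorted_proj H k T \<theta> ! j\<bar>))"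
    proof (rule outside_small_mono)
      fix \<theta> assume E: "\<forall>st\<in>?P. ?E st \<theta>"
      have S: "S \<subseteq> {1..n}" and T: "T \<subseteq> {1..n}" using G H by (auto simp: graph_in_def)
      have card: "card S \<le> n" "card T \<le> n" using card_mono[OF _ S] card_mono[OF _ T] by auto
      show "\<epsilon> * Wpad n z tree_dist (tree_list G k S) (tree_list H k T)
        \<le> (\<Sum>j<n. \<bar>sorted_proj G k S \<theta> ! j - sorted_proj H k T \<theta> ! j\<bar>)"
        unfolding tree_list_def sorted_proj_def
      proof (rule sort_distance_ge_Wpad[OF mset_map_pad[OF S] _ mset_map_pad[OF T]])
        fix i j assume ij: "i < n" "j < n"
        \<comment> \<open>Slots are numbered from 1, list positions from 0.\<close>
        then have "(Suc i, Suc j) \<in> ?P" by auto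
        from bspec[OF E this] ij
        show "\<epsilon> * tree_dist (map ?ts [1..<Suc n] ! i) (map ?us [1..<Suc n] ! j)
          \<le> \<bar>map (\<lambda>s. dotp ?m (?a \<theta>) (padded G k S s \<theta>)) [1..<Suc n] ! i -
             map (\<lambda>s. dotp ?m (?a \<theta>) (padded H k T s \<theta>)) [1..<Suc n] ! j\<bar>"
          by (simp del: upt_Suc split del: if_split cong: if_cong)
      qed (use card \<epsilon> in auto)
    qed simp
  qed
qed

text \<open>The tree distance is at most a root part plus a matching of children. The old features
  control the first, the sorted projections the second, and the fresh parameter
  \<open>PD (Suc k)\<close> keeps a fixed share of their sum; each of the three events gets
  \<open>\<eta> / 3\<close>.\<close>

lemma separates_nodes_Suc:
  assumes k: "Suc k \<le> K" and sep: "separates_nodes k"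
  shows "separates_nodes (Suc k)"
  unfolding separates_nodes_def
proof (intro allI impI)
  fix \<eta> :: real assume "0 < \<eta>"
  then have \<eta>: "0 < \<eta> / 3" by simp
  have k': "k \<le> K" using k by simp
  let ?m = "dimx d k" and ?i = "PD (Suc k)"
  have m: "0 < real ?m" using dimx_pos by simp
  obtain \<epsilon>1 where \<epsilon>1: "0 < \<epsilon>1"
    "\<And>w. independent_of ?i w \<Longrightarrow>
      outside_small M (\<eta> / 3) (\<lambda>\<theta>. \<epsilon>1 * l1norm (?m + n) (w \<theta>) \<le> \<bar>dotp (?m + n) (\<theta> ?i) (w \<theta>)\<bar>)"
    by (rule dotp_anticoncentration[OF PD_in[OF k] \<eta>, unfolded pdim_PD]) (rule that)
  obtain \<epsilon>2 where \<epsilon>2: "0 < \<epsilon>2" "\<And>G H v u.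
     graph_in n \<Omega> G \<and> graph_in n \<Omega> H \<and> v \<in> verts G \<and> u \<in> verts H \<Longrightarrow>
     outside_small M (\<eta> / 3) (\<lambda>\<theta>. \<epsilon>2 * tree_dist (comp_tree G k v) (comp_tree H k u)
        \<le> pnorm ?m p (\<lambda>i. x G k v \<theta> i - x H k u \<theta> i))"
    using sep \<eta> unfolding separates_nodes_def by blast
  obtain \<epsilon>3 where \<epsilon>3: "0 < \<epsilon>3"
    "\<And>G H S T. graph_in n \<Omega> G \<Longrightarrow> graph_in n \<Omega> H \<Longrightarrow> S \<subseteq> verts G \<Longrightarrow> T \<subseteq> verts H \<Longrightarrow>
      outside_small M (\<eta> / 3) (\<lambda>\<theta>. \<epsilon>3 * Wpad n z tree_dist (tree_list G k S) (tree_list H k T)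
        \<le> (\<Sum>j<n. \<bar>sorted_proj G k S \<theta> ! j - sorted_proj H k T \<theta> ! j\<bar>))"
    by (rule sorted_proj_separated[OF k' sep \<eta>]) (rule that)
  \<comment> \<open>The worse of the factors for the root part, \<open>\<epsilon>2 / ?m\<close>, and
    for the children, \<open>\<epsilon>3\<close>.\<close>
  define \<epsilon>4 where "\<epsilon>4 = min (\<epsilon>2 / ?m) \<epsilon>3"
  have \<epsilon>4: "0 < \<epsilon>4" "\<epsilon>4 \<le> \<epsilon>2 / ?m" "\<epsilon>4 \<le> \<epsilon>3" using \<epsilon>2(1) \<epsilon>3(1) m by (auto simp: \<epsilon>4_def)
  show "\<exists>\<epsilon>>0. \<forall>G H v u.
     graph_in n \<Omega> G \<and> graph_in n \<Omega> H \<and> v \<in> verts G \<and> u \<in> verts H \<longrightarrow>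
     outside_small M \<eta> (\<lambda>\<theta>. \<epsilon> * tree_dist (comp_tree G (Suc k) v) (comp_tree H (Suc k) u)
        \<le> pnorm (dimx d (Suc k)) p (\<lambda>i. x G (Suc k) v \<theta> i - x H (Suc k) u \<theta> i))"
  proof (intro exI[of _ "\<epsilon>1 * \<epsilon>4"] conjI allI impI)
    show "0 < \<epsilon>1 * \<epsilon>4" using \<epsilon>1(1) \<epsilon>4(1) by simp
    fix G H v u assume GH: "graph_in n \<Omega> G \<and> graph_in n \<Omega> H \<and> v \<in> verts G \<and> u \<in> verts H"
    let ?S = "{s. (v, s) \<in> edges G}" and ?T = "{s. (u, s) \<in> edges H}"
    have S: "?S \<subseteq> verts G" and T: "?T \<subseteq> verts H" using GH by (auto simp: graph_in_def)
    \<comment> \<open>Edges stay inside \<open>verts\<close>, so the children in the tree are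
      exactly the unpadded slots of the aggregation.\<close>
    have nb: "nbrs G v = sorted_list_of_set ?S" "nbrs H u = sorted_list_of_set ?T"
      unfolding nbrs_def using S T by (auto intro!: arg_cong[where f=sorted_list_of_set])
    let ?w = "\<lambda>\<theta> i. concat_feat G k v \<theta> i - concat_feat H k u \<theta> i"
    let ?W = "Wpad n z tree_dist (tree_list G k ?S) (tree_list H k ?T)"
    let ?r = "pnorm d p (\<lambda>i. feats G v i - feats H u i)"
    have "outside_small M (\<eta> / 3) (\<lambda>\<theta>. \<epsilon>1 * l1norm (?m + n) (?w \<theta>) \<le> \<bar>dotp (?m + n) (\<theta> ?i) (?w \<theta>)\<bar>)"
      by (rule \<epsilon>1(2)) (auto simp: independent_of_def concat_feat_upd intro!: borel_measurable_diff concat_feat_measurable k')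
    from outside_small_conj[OF this outside_small_conj[OF \<epsilon>2(2)[OF GH] \<epsilon>3(2)[OF _ _ S T]]] \<eta> GH
    have "outside_small M (\<eta> / 3 + (\<eta> / 3 + \<eta> / 3)) (\<lambda>\<theta>.
        \<epsilon>1 * l1norm (?m + n) (?w \<theta>) \<le> \<bar>dotp (?m + n) (\<theta> ?i) (?w \<theta>)\<bar> \<and>
        \<epsilon>2 * tree_dist (comp_tree G k v) (comp_tree H k u) \<le> pnorm ?m p (\<lambda>i. x G k v \<theta> i - x H k u \<theta> i) \<and>
        \<epsilon>3 * ?W \<le> (\<Sum>j<n. \<bar>sorted_proj G k ?S \<theta> ! j - sorted_proj H k ?T \<theta> ! j\<bar>))" by simp
    then show "outside_small M \<eta> (\<lambda>\<theta>. \<epsilon>1 * \<epsilon>4 * tree_dist (comp_tree G (Suc k) v) (comp_tree H (Suc k) u)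
        \<le> pnorm (dimx d (Suc k)) p (\<lambda>i. x G (Suc k) v \<theta> i - x H (Suc k) u \<theta> i))"
    proof (rule outside_small_mono)
      fix \<theta> assume A: "\<epsilon>1 * l1norm (?m + n) (?w \<theta>) \<le> \<bar>dotp (?m + n) (\<theta> ?i) (?w \<theta>)\<bar> \<and>
        \<epsilon>2 * tree_dist (comp_tree G k v) (comp_tree H k u) \<le> pnorm ?m p (\<lambda>i. x G k v \<theta> i - x H k u \<theta> i) \<and>
        \<epsilon>3 * ?W \<le> (\<Sum>j<n. \<bar>sorted_proj G k ?S \<theta> ! j - sorted_proj H k ?T \<theta> ! j\<bar>)"
      have W0: "0 \<le> ?W" by (rule Wpad_nonneg) simp
      \<comment> \<open>The roots at depths \<open>k\<close> and \<open>k + 1\<close> agree, so the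
        distance at depth \<open>k\<close> already contains the root term.\<close>
      have "\<epsilon>2 * ?r \<le> \<epsilon>2 * tree_dist (comp_tree G k v) (comp_tree H k u)"
        using \<epsilon>2(1) root_le_TD[of d p "comp_tree G k v" "comp_tree H k u" n z]
        by (simp add: tree_dist_def)
      also have "\<dots> \<le> ?m * l1norm ?m (\<lambda>i. x G k v \<theta> i - x H k u \<theta> i)"
        using A pnorm_le_l1norm[OF p] by (meson order_trans)
      finally have "\<epsilon>2 / ?m * ?r \<le> l1norm ?m (\<lambda>i. x G k v \<theta> i - x H k u \<theta> i)"
        using m by (simp add: field_simps)
      moreover have "\<epsilon>4 * ?r \<le> \<epsilon>2 / ?m * ?r" "\<epsilon>4 * ?W \<le> \<epsilon>3 * ?W"
        by (rule mult_right_mono[OF \<epsilon>4(2) pnorm_nonneg] mult_right_mono[OF \<epsilon>4(3) W0])+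
      ultimately have "\<epsilon>4 * (?r + ?W) \<le> l1norm (?m + n) (?w \<theta>)"
        unfolding l1norm_concat_diff using A by (simp add: distrib_left)
      moreover have "tree_dist (comp_tree G (Suc k) v) (comp_tree H (Suc k) u) \<le> ?r + ?W"
        using TD_le_root_plus_Wpad[of n d p z "comp_tree G (Suc k) v" "comp_tree H (Suc k) u"]
        by (simp add: comp_tree_Suc tree_list_def nb tree_dist_def)
      then have "\<epsilon>4 * tree_dist (comp_tree G (Suc k) v) (comp_tree H (Suc k) u) \<le> \<epsilon>4 * (?r + ?W)"
        using \<epsilon>4(1) by simp
      ultimately have "\<epsilon>1 * (\<epsilon>4 * tree_dist (comp_tree G (Suc k) v) (comp_tree H (Suc k) u))
          \<le> \<epsilon>1 * l1norm (?m + n) (?w \<theta>)"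
        using \<epsilon>1(1) by (intro mult_left_mono) auto
      also have "\<dots> \<le> \<bar>dotp (?m + n) (\<theta> ?i) (?w \<theta>)\<bar>" using A by blast
      also have "\<dots> = pnorm (dimx d (Suc k)) p (\<lambda>i. x G (Suc k) v \<theta> i - x H (Suc k) u \<theta> i)"
        using p pnorm_1[of p] by (simp add: dimx_def[of _ "Suc k"] feat_Suc dotp_diff)
      finally show "\<epsilon>1 * \<epsilon>4 * tree_dist (comp_tree G (Suc k) v) (comp_tree H (Suc k) u)
        \<le> pnorm (dimx d (Suc k)) p (\<lambda>i. x G (Suc k) v \<theta> i - x H (Suc k) u \<theta> i)"
        by (simp only: mult.assoc)
    qed simp
  qed
qed

lemma separates_nodes: "k \<le> K \<Longrightarrow> separates_nodes k"
  by (induction k) (auto intro: separates_nodes_0 separates_nodes_Suc)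

section \<open>From probability to expectation\<close>

lemma integrable_powr_of_bounded:
  assumes f: "f \<in> borel_measurable M" and C: "\<And>\<theta>. \<theta> \<in> valid_params n d K \<Longrightarrow> \<bar>f \<theta>\<bar> \<le> C"
  shows "integrable M (\<lambda>\<theta>. \<bar>f \<theta>\<bar> powr p)"
proof (rule integrable_const_bound[where B="C powr p"])
  show "AE \<theta> in M. norm (\<bar>f \<theta>\<bar> powr p) \<le> C powr p"
    using AE_valid by (rule AE_mp) (use C p in \<open>auto intro!: powr_mono2\<close>)
qed (use f in measurable)

text \<open>Separation at level \<open>\<eta> = 1/2\<close> makes the integrand at least
  \<open>\<epsilon> powr p\<close> times the tree distance to the power \<open>p\<close> with
  probability at least 1/2.\<close>

lemma node_lower_bound:
  assumes k: "k \<le> K"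
  shows "\<exists>c>0. \<forall>G H v u. graph_in n \<Omega> G \<and> graph_in n \<Omega> H \<and> v \<in> verts G \<and> u \<in> verts H \<longrightarrow>
    c * TD n d p z (comp_tree G k v) (comp_tree H k u) powr p \<le>
    (\<integral>\<theta>. pnorm (dimx d k) p (\<lambda>i. x G k v \<theta> i - x H k u \<theta> i) powr p \<partial>M)"
proof -
  have half: "0 < (1/2 :: real)" by simp
  obtain \<epsilon> where \<epsilon>: "0 < \<epsilon>" "\<And>G H v u.
     graph_in n \<Omega> G \<and> graph_in n \<Omega> H \<and> v \<in> verts G \<and> u \<in> verts H \<Longrightarrow>
     outside_small M (1/2) (\<lambda>\<theta>. \<epsilon> * tree_dist (comp_tree G k v) (comp_tree H k u)
        \<le> pnorm (dimx d k) p (\<lambda>i. x G k v \<theta> i - x H k u \<theta> i))"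
    using separates_nodes[OF k] half unfolding separates_nodes_def by blast
  show ?thesis
  proof (intro exI[of _ "\<epsilon> powr p / 2"] conjI allI impI)
    fix G H v u
    assume GH: "graph_in n \<Omega> G \<and> graph_in n \<Omega> H \<and> v \<in> verts G \<and> u \<in> verts H"
    let ?t = "tree_dist (comp_tree G k v) (comp_tree H k u)"
    let ?f = "\<lambda>\<theta>. pnorm (dimx d k) p (\<lambda>i. x G k v \<theta> i - x H k u \<theta> i)"
    obtain C1 where C1: "\<And>\<theta> i. \<theta> \<in> valid_params n d K \<Longrightarrow> i < dimx d k \<Longrightarrow> \<bar>x G k v \<theta> i\<bar> \<le> C1"
      using feat_bounded[OF k] by blast
    obtain C2 where C2: "\<And>\<theta> i. \<theta> \<in> valid_params n d K \<Longrightarrow> i < dimx d k \<Longrightarrow> \<bar>x H k u \<theta> i\<bar> \<le> C2"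
      using feat_bounded[OF k] by blast
    have [measurable]: "(\<lambda>\<theta>. x G k v \<theta> i - x H k u \<theta> i) \<in> borel_measurable M" if "i < dimx d k" for i
      using k that by (intro borel_measurable_diff feat_measurable)
    have "?f \<in> borel_measurable M" unfolding pnorm_def
      by (intro powr_real_measurable borel_measurable_sum borel_measurable_abs borel_measurable_const) auto
    moreover have "\<bar>?f \<theta>\<bar> \<le> dimx d k * (dimx d k * (C1 + C2))" if \<theta>: "\<theta> \<in> valid_params n d K" for \<theta>
    proof -
      have "l1norm (dimx d k) (\<lambda>i. x G k v \<theta> i - x H k u \<theta> i) \<le> (\<Sum>i<dimx d k. C1 + C2)"
        unfolding l1norm_def using C1[OF \<theta>] C2[OF \<theta>] by (intro sum_mono) (smt (verit) lessThan_iff)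
      then have "dimx d k * l1norm (dimx d k) (\<lambda>i. x G k v \<theta> i - x H k u \<theta> i) \<le> dimx d k * (dimx d k * (C1 + C2))"
        by (intro mult_left_mono) auto
      with pnorm_le_l1norm[OF p, of "dimx d k" "\<lambda>i. x G k v \<theta> i - x H k u \<theta> i"] show ?thesis
        using pnorm_nonneg by (metis abs_of_nonneg order_trans)
    qed
    ultimately have "integrable M (\<lambda>\<theta>. \<bar>?f \<theta>\<bar> powr p)"
      by (rule integrable_powr_of_bounded)
    then have int: "integrable M (\<lambda>\<theta>. ?f \<theta> powr p)" by simp
    have "outside_small M (1/2) (\<lambda>\<theta>. \<epsilon> * ?t \<le> ?f \<theta>)" using GH by (rule \<epsilon>(2))
    then have "outside_small M (1/2) (\<lambda>\<theta>. (\<epsilon> * ?t) powr p \<le> ?f \<theta> powr p)"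
      by (rule outside_small_mono) (use \<epsilon>(1) p in \<open>auto intro!: powr_mono2\<close>)
    from integral_ge_of_outside_small[OF int _ _ this]
    have "(\<epsilon> * ?t) powr p / 2 \<le> (\<integral>\<theta>. ?f \<theta> powr p \<partial>M)" by simp
    then show "\<epsilon> powr p / 2 * TD n d p z (comp_tree G k v) (comp_tree H k u) powr p
        \<le> (\<integral>\<theta>. ?f \<theta> powr p \<partial>M)"
      using \<epsilon>(1) TD_nonneg by (simp add: powr_mult tree_dist_def)
  qed (use \<epsilon> in simp)
qed

text \<open>The readout is one more sorted projection, now over all slots, followed by a projection
  with the fresh parameter \<open>PB\<close>; an exceptional probability of 1/4 for each leaves one
  half.\<close>

lemma graph_lower_bound:
  obtains c where "0 < c" "\<And>G H. graph_in n \<Omega> G \<Longrightarrow> graph_in n \<Omega> H \<Longrightarrow>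
    c * TMD n d p z K G H powr p \<le>
    (\<integral>\<theta>. \<bar>readout n d zs K G \<theta> - readout n d zs K H \<theta>\<bar> powr p \<partial>M)"
proof -
  have quarter: "0 < (1/4 :: real)" by simp
  obtain \<epsilon>1 where \<epsilon>1: "0 < \<epsilon>1"
    "\<And>w. independent_of PB w \<Longrightarrow>
      outside_small M (1/4) (\<lambda>\<theta>. \<epsilon>1 * l1norm n (w \<theta>) \<le> \<bar>dotp n (\<theta> PB) (w \<theta>)\<bar>)"
    by (rule dotp_anticoncentration[OF PB_in quarter, unfolded pdim_PB]) (rule that)
  obtain \<epsilon>2 where \<epsilon>2: "0 < \<epsilon>2"
    "\<And>G H S T. graph_in n \<Omega> G \<Longrightarrow> graph_in n \<Omega> H \<Longrightarrow> S \<subseteq> verts G \<Longrightarrow> T \<subseteq> verts H \<Longrightarrow>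
      outside_small M (1/4) (\<lambda>\<theta>. \<epsilon>2 * Wpad n z tree_dist (tree_list G K S) (tree_list H K T)
        \<le> (\<Sum>j<n. \<bar>sorted_proj G K S \<theta> ! j - sorted_proj H K T \<theta> ! j\<bar>))"
    by (rule sorted_proj_separated[OF order_refl separates_nodes[OF order_refl] quarter]) (rule that)
  show thesis
  proof (rule that[of "(\<epsilon>1 * \<epsilon>2) powr p / 2"])
    fix G H assume GH: "graph_in n \<Omega> G" "graph_in n \<Omega> H"
    let ?t = "TMD n d p z K G H"
    let ?f = "\<lambda>\<theta>. readout n d zs K G \<theta> - readout n d zs K H \<theta>"
    let ?w = "\<lambda>\<theta> j. list_vec (sorted_proj G K (verts G) \<theta>) j - list_vec (sorted_proj H K (verts H) \<theta>) j"
    have t: "?t = Wpad n z tree_dist (tree_list G K (verts G)) (tree_list H K (verts H))"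
      by (simp add: TMD_def tree_dist_def tree_list_def)
    have t0: "0 \<le> ?t" unfolding t by (rule Wpad_nonneg) simp
    have f: "?f \<theta> = dotp n (\<theta> PB) (?w \<theta>)" for \<theta> by (simp add: readout_eq dotp_diff)
    have w: "l1norm n (?w \<theta>) = (\<Sum>j<n. \<bar>sorted_proj G K (verts G) \<theta> ! j - sorted_proj H K (verts H) \<theta> ! j\<bar>)" for \<theta>
      by (simp add: l1norm_def list_vec_def)
    obtain C1 where C1: "\<And>\<theta>. \<theta> \<in> valid_params n d K \<Longrightarrow> \<bar>readout n d zs K G \<theta>\<bar> \<le> C1"
      using readout_bounded by blast
    obtain C2 where C2: "\<And>\<theta>. \<theta> \<in> valid_params n d K \<Longrightarrow> \<bar>readout n d zs K H \<theta>\<bar> \<le> C2"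
      using readout_bounded by blast
    have int: "integrable M (\<lambda>\<theta>. \<bar>?f \<theta>\<bar> powr p)"
    proof (rule integrable_powr_of_bounded)
      show "?f \<in> borel_measurable M" by (intro borel_measurable_diff readout_measurable)
      show "\<bar>?f \<theta>\<bar> \<le> C1 + C2" if "\<theta> \<in> valid_params n d K" for \<theta>
        using C1[OF that] C2[OF that] by linarith
    qed
    have "outside_small M (1/4) (\<lambda>\<theta>. \<epsilon>1 * l1norm n (?w \<theta>) \<le> \<bar>dotp n (\<theta> PB) (?w \<theta>)\<bar>)"
      by (rule \<epsilon>1(2)) (auto simp: independent_of_def sorted_proj_upd intro!: borel_measurable_diff sorted_proj_measurable)
    from outside_small_conj[OF this \<epsilon>2(2)[OF GH order_refl order_refl]]
    have "outside_small M (1/4 + 1/4) (\<lambda>\<theta>. \<epsilon>1 * l1norm n (?w \<theta>) \<le> \<bar>?f \<theta>\<bar> \<and> \<epsilon>2 * ?t \<le> l1norm n (?w \<theta>))"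
      by (simp add: f t w)
    then have "outside_small M (1/2) (\<lambda>\<theta>. (\<epsilon>1 * \<epsilon>2 * ?t) powr p \<le> \<bar>?f \<theta>\<bar> powr p)"
    proof (rule outside_small_mono)
      fix \<theta> assume A: "\<epsilon>1 * l1norm n (?w \<theta>) \<le> \<bar>?f \<theta>\<bar> \<and> \<epsilon>2 * ?t \<le> l1norm n (?w \<theta>)"
      then have "\<epsilon>1 * (\<epsilon>2 * ?t) \<le> \<epsilon>1 * l1norm n (?w \<theta>)" using \<epsilon>1(1) by (intro mult_left_mono) auto
      then have "\<epsilon>1 * \<epsilon>2 * ?t \<le> \<bar>?f \<theta>\<bar>" using A by (simp add: mult.assoc)
      then show "(\<epsilon>1 * \<epsilon>2 * ?t) powr p \<le> \<bar>?f \<theta>\<bar> powr p"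
        using \<epsilon>1(1) \<epsilon>2(1) t0 p by (intro powr_mono2) auto
    qed simp
    from integral_ge_of_outside_small[OF int _ _ this]
    have "(\<epsilon>1 * \<epsilon>2 * ?t) powr p / 2 \<le> (\<integral>\<theta>. \<bar>?f \<theta>\<bar> powr p \<partial>M)" by simp
    then show "(\<epsilon>1 * \<epsilon>2) powr p / 2 * ?t powr p \<le> (\<integral>\<theta>. \<bar>?f \<theta>\<bar> powr p \<partial>M)"
      using \<epsilon>1(1) \<epsilon>2(1) t0 by (simp add: powr_mult)
  qed (use \<epsilon>1 \<epsilon>2 in simp)
qed

end

theorem mainTheorem13:
  fixes p :: real and n d K :: nat
    and \<Omega> :: "(nat \<Rightarrow> real) set"
    and zs :: "nat \<Rightarrow> nat \<Rightarrow> real"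
    and z :: "nat \<Rightarrow> real"
  assumes "p \<ge> 1" and "n \<ge> 1" and "d \<ge> 1"
    and "compact \<Omega>" and "\<forall>x\<in>\<Omega>. supported d x"
    and "supported d z" and "z \<notin> \<Omega>"
    and "\<forall>k. supported (dimx d k) (zs k)"
    and "\<forall>k\<le>K. zs k \<notin> Omega_k n d \<Omega> zs K k"
  shows "\<exists>c1>0. \<exists>c2>0.
    (\<forall>k\<le>K. \<forall>G H v u. graph_in n \<Omega> G \<and> graph_in n \<Omega> H \<and> v \<in> verts G \<and> u \<in> verts H \<longrightarrow>
        (\<integral>\<theta>. pnorm (dimx d k) p (\<lambda>i. feat n d zs G \<theta> k v i - feat n d zs H \<theta> k u i) powr p
           \<partial>param_measure n d K)
        \<ge> c1 * TD n d p z (comp_tree G k v) (comp_tree H k u) powr p)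
  \<and> (\<forall>G H. graph_in n \<Omega> G \<and> graph_in n \<Omega> H \<longrightarrow>
        (\<integral>\<theta>. \<bar>readout n d zs K G \<theta> - readout n d zs K H \<theta>\<bar> powr p \<partial>param_measure n d K)
        \<ge> c2 * TMD n d p z K G H powr p)"
proof -
  interpret thin_sort_mpnn p n d K \<Omega> zs z
    using assms by unfold_locales auto
  let ?bound = "\<lambda>k c. 0 < c \<and> (\<forall>G H v u.
      graph_in n \<Omega> G \<and> graph_in n \<Omega> H \<and> v \<in> verts G \<and> u \<in> verts H \<longrightarrow>
      c * TD n d p z (comp_tree G k v) (comp_tree H k u) powr p \<le>
      (\<integral>\<theta>. pnorm (dimx d k) p (\<lambda>i. feat n d zs G \<theta> k v i - feat n d zs H \<theta> k u i) powr p
        \<partial>param_measure n d K))"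
  have "\<forall>k\<in>{..K}. \<exists>c. ?bound k c" by (intro ballI node_lower_bound) simp
  from bchoice[OF this] obtain c where c: "\<forall>k\<in>{..K}. ?bound k (c k)" ..
  obtain c2 where c2: "0 < c2" "\<And>G H. graph_in n \<Omega> G \<Longrightarrow> graph_in n \<Omega> H \<Longrightarrow>
      c2 * TMD n d p z K G H powr p \<le>
      (\<integral>\<theta>. \<bar>readout n d zs K G \<theta> - readout n d zs K H \<theta>\<bar> powr p \<partial>param_measure n d K)"
    by (rule graph_lower_bound) (rule that)
  \<comment> \<open>One constant for all levels: the minimum of finitely many positive ones.\<close>
  define c1 where "c1 = Min (c ` {..K})"
  have c1: "0 < c1" unfolding c1_def using c by (subst Min_gr_iff) auto
  have "c1 * TD n d p z (comp_tree G k v) (comp_tree H k u) powr p \<le>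
      (\<integral>\<theta>. pnorm (dimx d k) p (\<lambda>i. feat n d zs G \<theta> k v i - feat n d zs H \<theta> k u i) powr p
        \<partial>param_measure n d K)"
    if "k \<le> K" "graph_in n \<Omega> G \<and> graph_in n \<Omega> H \<and> v \<in> verts G \<and> u \<in> verts H" for k G H v u
  proof -
    have "c1 \<le> c k" unfolding c1_def using that(1) by (intro Min_le) auto
    then have "c1 * TD n d p z (comp_tree G k v) (comp_tree H k u) powr p \<le>
        c k * TD n d p z (comp_tree G k v) (comp_tree H k u) powr p"
      by (intro mult_right_mono) auto
    also have "\<dots> \<le> (\<integral>\<theta>. pnorm (dimx d k) p (\<lambda>i. feat n d zs G \<theta> k v i - feat n d zs H \<theta> k u i) powr p
        \<partial>param_measure n d K)"
      using c that by simp
    finally show ?thesis .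
  qed
  then show ?thesis using c1 c2 by (intro exI[of _ c1] exI[of _ c2] conjI allI impI) auto
qed

end
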